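(* Let $d\geq1$, $k\geq1$, $(\boldsymbol\mu,\rho)\in\mathbb{S}^d\times[-1,1]$, $\boldsymbol X\sim\mathrm{C}_k(\boldsymbol\mu,\rho)$, and $m\geq1$. Let $\boldsymbol U\sim\mathrm{Unif}(\mathbb{S}^d)$ and $$\boldsymbol\mu_{d+1,m}:=\mathbb{E}[\boldsymbol U^{\otimes m}]=\frac{(m-1)!!}{\prod_{r=0}^{m/2-1}(d+1+2r)}\,\boldsymbol S_{d+1,m}(\operatorname{vec}\boldsymbol I_{d+1})^{\otimes m/2}\,1_{\{m\text{ even}\}}.$$ Then: (i) If $m<k$, $\mathbb{E}[\boldsymbol X^{\otimes m}]=\boldsymbol\mu_{d+1,m}$. (ii) If $m=k$, $$\mathbb{E}[\boldsymbol X^{\otimes k}]=\boldsymbol\mu_{d+1,k}+\frac{\rho}{d_{k,d}}\,\boldsymbol S_{d+1,k}\sum_{j=0}^{\lfloor k/2\rfloor}a_{k,j}(\operatorname{vec}\boldsymbol I_{d+1})^{\otimes j}\otimes\boldsymbol\mu^{\otimes k-2j},$$ where $a_{k,0}=1$ and $a_{k,j}=(-1)^j\frac{k!}{2^j(k-2j)!j!}\frac{1}{\prod_{r=1}^j(2(k-r)+d-1)}$. (iii) If $m>k$ and $m-k$ is odd, $\mathbb{E}[\boldsymbol X^{\otimes m}]=\boldsymbol\mu_{d+1,m}$. (iv) For general $m\geq1$, $$\mathbb{E}[\boldsymbol X^{\otimes m}]=\boldsymbol\mu_{d+1,m}+\frac{\rho}{C_k^{(d-1)/2}(1)}\frac{\omega_{d-1}}{\omega_d}\,\boldsymbol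 S_{d+1,m}\sum_{j=0}^{\lfloor m/2\rfloor}e_{j,k,m}\,\boldsymbol\mu^{\otimes(m-2j)}\otimes\big[(\operatorname{vec}\boldsymbol I_{d+1}-\boldsymbol\mu^{\otimes2})^{\otimes j}\big],$$ where $e_{j,k,m}:=\binom{m}{2j}\frac{(2j-1)!!}{\prod_{r=0}^{j-1}(d+2r)}f_{j,m,k}1_{\{m+k\text{ even}\}}$, $$f_{j,m,k}:=\int_{-1}^1t^{m-2j}(1-t^2)^{d/2-1+j}C_k^{(d-1)/2}(t)\,\mathrm dt=\frac{\Gamma(d/2+j)}{g_{k,d}}\sum_{s=0}^{\lfloor k/2\rfloor}(-1)^s\frac{2^{k-2s}\Gamma((d-1)/2+k-s)}{s!(k-2s)!}\frac{\Gamma((m+k+1)/2-j-s)}{\Gamma((d+k+m+1)/2-s)},$$ and $g_{k,d}=k/2$ if $d=1$, $g_{k,d}=[\Gamma((d-1)/2)]^{-1}$ if $d\geq2$.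
   Context: For an integer $d\geq1$, $\mathbb{S}^d=\{\boldsymbol x\in\mathbb{R}^{d+1}:\|\boldsymbol x\|=1\}$, $\sigma_d$ is its surface area measure and $\omega_d=2\pi^{(d+1)/2}/\Gamma((d+1)/2)$ (with $\omega_0=2$). For $d\geq2$, $C_k^{(d-1)/2}$ is the standard Gegenbauer polynomial of degree $k$ and index $(d-1)/2$ (generating function $(1-2xt+t^2)^{-(d-1)/2}$, so $C_k^{(d-1)/2}(1)=\Gamma(d-1+k)/(\Gamma(d-1)k!)$); for $d=1$, $C_k^0:=T_k$, $T_k(x)=\cos(k\cos^{-1}x)$. $\tilde C_k^{(d-1)/2}=C_k^{(d-1)/2}/C_k^{(d-1)/2}(1)$. $d_{k,d}=(1+2k/(d-1))\Gamma(d-1+k)/(\Gamma(d-1)k!)$ for $d\geq2$, $d_{k,1}=2-\delta_{k,0}$. $\mathrm{C}_k(\boldsymbol\mu,\rho)$ ($\boldsymbol\mu\in\mathbb{S}^d$, $\rho\in[-1,1]$, integer $k\geq1$) is the distribution on $\mathbb{S}^d$ with density $\omega_d^{-1}\{1+\rho\,\tilde C_k^{(d-1)/2}(\boldsymbol x^\top\boldsymbol\mu)\}$ w.r.t. $\sigma_d$; $\mathrm{Unif}(\mathbb{S}^d)$ has density $1/\omega_d$. $\otimes$ is the Kronecker product, $\boldsymbol x^{\otimes r}$ the $r$-fold Kronecker power, $\operatorname{vec}$ stacks columns of a matrix, and $\boldsymbol S_{d+1,r}$ is the $(d+1)^r\times(d+1)^r$ symmetrizer matrix: $\boldsymbol S_{d+1,r}(\boldsymbol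 v_1\otimes\cdots\otimes\boldsymbol v_r)=\frac{1}{r!}\sum_{\sigma\in S_r}\boldsymbol v_{\sigma(1)}\otimes\cdots\otimes\boldsymbol v_{\sigma(r)}$ for $\boldsymbol v_i\in\mathbb{R}^{d+1}$. Empty products equal $1$ and $(-1)!!=1$.
   Formalization: The printed closed form of f_{j,m,k} is false (d=2, k=m=1, j=0: it gives 2π/3, the integral is 2/3); it is proved with multiplication by g_{k,d} instead of division, and only for m+k even, since for m+k odd the integral is 0 while the formula need not be. *)

theory Defs
  imports "HOL-Probability.Probability" "HOL-Combinatorics.Permutations"
begin

definition omega :: "nat \<Rightarrow> real" where
  "omega d = 2 * pi powr ((real d + 1) / 2) / Gamma ((real d + 1) / 2)"

(* Gegenbauer polynomial C_k^a(x) via its generating function (1 - 2xt + t^2)^(-a):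
   the k-th Taylor coefficient at t = 0 *)
definition gegen_gf :: "real \<Rightarrow> nat \<Rightarrow> real \<Rightarrow> real" where
  "gegen_gf a k x = (deriv ^^ k) (\<lambda>t. (1 - 2 * x * t + t ^ 2) powr (- a)) 0 / fact k"

(* C_k^{(d-1)/2}; for d = 1 it is the Chebyshev polynomial T_k *)
definition gegen :: "nat \<Rightarrow> nat \<Rightarrow> real \<Rightarrow> real" where
  "gegen d k x = (if d = 1 then cos (real k * arccos x) else gegen_gf ((real d - 1) / 2) k x)"

definition gegen_norm :: "nat \<Rightarrow> nat \<Rightarrow> real \<Rightarrow> real" where
  "gegen_norm d k x = gegen d k x / gegen d k 1"

definition dkd :: "nat \<Rightarrow> nat \<Rightarrow> real" where
  "dkd k d = (if d = 1 then (if k = 0 then 1 else 2)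
     else (1 + 2 * real k / (real d - 1)) * Gamma (real d - 1 + real k) / (Gamma (real d - 1) * fact k))"

(* surface area measure sigma_d on the unit sphere of real^'n (d+1 = CARD('n)), as the
   cone measure: sigma(A) = (d+1) * lebesgue {x. 0 < |x| <= 1, x/|x| in A} *)
definition sphere_measure :: "(real^'n) measure" where
  "sphere_measure = density
     (distr (density lborel (indicator (cball 0 1 - {0}))) borel (\<lambda>x. x /\<^sub>R norm x))
     (\<lambda>_. ennreal (real CARD('n)))"

definition unif_sphere :: "(real^'n) measure" where
  "unif_sphere = density sphere_measure (\<lambda>_. ennreal (1 / omega (CARD('n) - 1)))"

definition Cdist :: "nat \<Rightarrow> real^'n \<Rightarrow> real \<Rightarrow> (real^'n) measure" where
  "Cdist k \<mu> \<rho> = density sphere_measure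
     (\<lambda>x. ennreal ((1 + \<rho> * gegen_norm (CARD('n) - 1) k (x \<bullet> \<mu>)) / omega (CARD('n) - 1)))"

(* Tensors of order r over R^{d+1}: an entry of a vector in R^{(d+1)^r} is indexed by the
   multi-index (i_1,...,i_r), represented as a list of length r (i_1 = slowest index,
   as for the Kronecker product). *)
type_synonym 'n tensor = "'n list \<Rightarrow> real"

definition tpow :: "real^'n \<Rightarrow> 'n tensor" where
  "tpow x is = prod_list (map (\<lambda>i. x $ i) is)"

definition vecI :: "'n tensor" where
  "vecI is = (if is ! 0 = is ! 1 then 1 else 0)"

definition tkron :: "nat \<Rightarrow> 'n tensor \<Rightarrow> 'n tensor \<Rightarrow> 'n tensor" where
  "tkron p A B is = A (take p is) * B (drop p is)"

definition tpowT :: "nat \<Rightarrow> 'n tensor \<Rightarrow> nat \<Rightarrow> 'n tensor" where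
  "tpowT p T j is = (\<Prod>l<j. T (take p (drop (l * p) is)))"

definition tsym :: "nat \<Rightarrow> 'n tensor \<Rightarrow> 'n tensor" where
  "tsym r T is = (\<Sum>\<sigma> | \<sigma> permutes {..<r}. T (map (\<lambda>l. is ! \<sigma> l) [0..<r])) / fact r"

definition oddfact :: "nat \<Rightarrow> real" where
  "oddfact j = (\<Prod>r<j. real (2 * r + 1))"

definition mu_unif :: "nat \<Rightarrow> nat \<Rightarrow> 'n tensor" where
  "mu_unif d m is = (if even m then
      oddfact (m div 2) / (\<Prod>r<m div 2. real d + 1 + 2 * real r) * tsym m (tpowT 2 vecI (m div 2)) is
    else 0)"

definition a_coef :: "nat \<Rightarrow> nat \<Rightarrow> nat \<Rightarrow> real" where
  "a_coef d k j = (-1) ^ j * fact k / (2 ^ j * fact (k - 2 * j) * fact j)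
      / (\<Prod>r\<in>{1..j}. 2 * (real k - real r) + real d - 1)"

definition f_int :: "nat \<Rightarrow> nat \<Rightarrow> nat \<Rightarrow> nat \<Rightarrow> real" where
  "f_int d k m j = (LBINT t=-1..1. t ^ (m - 2 * j) * (1 - t ^ 2) powr (real d / 2 - 1 + real j) * gegen d k t)"

definition g_kd :: "nat \<Rightarrow> nat \<Rightarrow> real" where
  "g_kd k d = (if d = 1 then real k / 2 else 1 / Gamma ((real d - 1) / 2))"

definition f_closed :: "nat \<Rightarrow> nat \<Rightarrow> nat \<Rightarrow> nat \<Rightarrow> real" where
  "f_closed d k m j = Gamma (real d / 2 + real j) * g_kd k d *
     (\<Sum>s\<le>k div 2. (-1) ^ s * 2 ^ (k - 2 * s) * Gamma ((real d - 1) / 2 + real k - real s)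
        / (fact s * fact (k - 2 * s))
        * Gamma ((real m + real k + 1) / 2 - real j - real s)
        / Gamma ((real d + real k + real m + 1) / 2 - real s))"

definition e_coef :: "nat \<Rightarrow> nat \<Rightarrow> nat \<Rightarrow> nat \<Rightarrow> real" where
  "e_coef d k m j = real (m choose (2 * j)) * oddfact j / (\<Prod>r<j. real d + 2 * real r)
     * f_int d k m j * (if even (m + k) then 1 else 0)"

end

theory Submission
  imports Defs "HOL-Complex_Analysis.Laurent_Convergence"
begin

text \<open>
  Symmetric tensors are determined by their contractions with \<open>v \<otimes> \<dots> \<otimes> v\<close> (polarization), so every
  claim reduces to integrals of \<open>(v \<bullet> x) ^ m * C (x \<bullet> \<mu>)\<close> over the uniform distribution on the sphere,
  where \<open>C\<close> is the Gegenbauer polynomial. Rotation invariance gives \<open>E (w \<bullet> x) ^ 2n = \<kappa> n * |w| ^ 2n\<close>, and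
  taking \<open>w = t \<mu> + v\<close> and comparing coefficients of \<open>t\<close> gives all mixed moments of \<open>\<mu> \<bullet> x\<close> and \<open>v \<bullet> x\<close>;
  the recursion for \<open>\<kappa>\<close> follows from \<open>|x| = 1\<close>. Inserting the explicit coefficients of \<open>C\<close>, the cases
  \<open>m < k\<close> and \<open>m = k\<close> become one alternating binomial sum of Gamma quotients, and the general case follows by
  splitting \<open>v\<close> into its components along and orthogonal to \<open>\<mu>\<close> and matching Beta integrals.
\<close>

section \<open>Explicit Gegenbauer and Chebyshev coefficients\<close>

text \<open>No polar coordinates or slicing along \<open>\<mu>\<close> occur. The surface measure is
  a cone measure, so rotation invariance, concentration on |x| = 1 and the total mass are all read
  off Lebesgue measure on the punctured unit ball. Consequently the integral \<open>f_int\<close>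
  never arises as an integral over slices of the sphere: it enters because mixed moments of
  orthogonal linear forms and Beta integrals have the same closed form in Gamma values. The mixed
  moment formula is stated for an unspecified constant, since the recursion that determines the
  constant uses this formula in the next degree. The cases m < k and m = k merge because a degree
  gap k - m = 2e produces, for each power of \<open>v \<bullet> v\<close>, a finite difference of
  order e + j carrying the product (e-1)(e-2)...; it has a zero factor when e \<ge> 1 and none when
  e = 0. The circle joins the higher spheres through one coefficient formula: after the density is
  replaced almost everywhere by a polynomial, nothing distinguishes Chebyshev from Gegenbauer except
  a prefactor.\<close>

text \<open>Taking out the factor X^i leaves a binomial power. The same quadratic occurs twice: as
  -2xt + t^2 in the generating function and as 2t(v.mu) + t^2 in the squared norm of t mu +
  v.\<close>

lemma coeff_X_mult_linear_power:
  fixes c :: "'a::comm_ring_1"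
  shows "coeff ([:0, c, 1:] ^ i) k = (if i \<le> k \<and> k \<le> 2 * i then of_nat (i choose (k - i)) * c ^ (2 * i - k) else 0)"
proof -
  have "[:0, c, 1:] = monom 1 1 * [:c, 1:]"
    by (simp add: monom_altdef)
  hence "[:0, c, 1:] ^ i = monom 1 i * [:c, 1:] ^ i"
    by (simp only: power_mult_distrib monom_power) simp
  hence "coeff ([:0, c, 1:] ^ i) k = (if k < i then 0 else coeff ([:c, 1:] ^ i) (k - i))"
    by (simp add: coeff_monom_mult)
  also have "\<dots> = (if i \<le> k \<and> k \<le> 2 * i then of_nat (i choose (k - i)) * c ^ (2 * i - k) else 0)"
    by (auto simp: coeff_linear_poly_power mult_2 coeff_eq_0 degree_linear_power)
  finally show ?thesis .
qed

lemma higher_deriv_0_has_fps_expansion: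
  fixes f :: "real \<Rightarrow> real"
  assumes "f has_fps_expansion F"
  shows "(deriv ^^ k) f 0 = fact k * fps_nth F k"
  using assms
proof (induction k arbitrary: f F)
  case 0
  thus ?case by (simp add: has_fps_expansion_imp_0_eq_fps_nth_0)
next
  case (Suc k)
  have "(deriv ^^ Suc k) f 0 = (deriv ^^ k) (deriv f) 0"
    by (simp add: funpow_swap1)
  also have "\<dots> = fact k * fps_nth (fps_deriv F) k"
    by (rule Suc.IH[OF has_fps_expansion_deriv[OF Suc.prems]])
  finally show ?case by (simp add: algebra_simps)
qed

lemma of_real_gbinomial: "(of_real a gchoose n :: complex) = of_real (a gchoose n)"
  by (simp add: gbinomial_prod_rev)

lemma eventually_gf_base_pos: "eventually (\<lambda>t. 1 - 2 * x * t + t ^ 2 > 0) (nhds (0::real))"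
proof -
  have "open {t::real. 1 - 2 * x * t + t ^ 2 > 0}"
    by (intro open_Collect_less continuous_intros)
  thus ?thesis
    by (auto simp: eventually_nhds intro!: exI[of _ "{t::real. 1 - 2 * x * t + t ^ 2 > 0}"])
qed

text \<open>The generating function is (1 + p(t))^(-a) with p(t) = t^2 - 2xt, so it is the binomial
  series composed with p. Since p(0) = 0, only the powers with i \<le> k reach the coefficient of
  t^k.\<close>

lemma gegen_gf_sum:
  "gegen_gf a k x = (\<Sum>i\<le>k. (- a gchoose i) * coeff ([:0, - 2 * x, 1:] ^ i) k)"
proof -
  define c where "c k = (\<Sum>i\<le>k. (- a gchoose i) * coeff ([:0, - 2 * x, 1:] ^ i) k)" for k
  let ?p = "[:0, - 2 * complex_of_real x, 1:]"
  let ?F = "fps_compose (fps_binomial (complex_of_real (- a))) (fps_of_poly ?p)"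
  \<comment> \<open>The composition is carried out over the complex numbers and then restricted to
    real t near 0, where the base is positive and the real and complex powers agree.\<close>
  have "((\<lambda>z. (1 + z) powr complex_of_real (- a)) \<circ> poly ?p) has_fps_expansion ?F"
    by (intro has_fps_expansion_compose has_fps_expansion_binomial_complex)
       (auto simp: has_fps_expansion_def)
  hence F: "fps_conv_radius ?F > 0"
     "eventually (\<lambda>z. eval_fps ?F z = (1 + poly ?p z) powr complex_of_real (- a)) (nhds 0)"
    by (auto simp: has_fps_expansion_def o_def)
  have coeff_c: "coeff (?p ^ i) k = of_real (coeff ([:0, - 2 * x, 1:] ^ i) k)" for i k
    by (simp add: coeff_X_mult_linear_power)
  have nth: "fps_nth ?F k = of_real (c k)" for k
    by (simp only: fps_compose_nth c_def fps_of_poly_power[symmetric] coeff_c of_real_gbinomial fps_binomial_nth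
       atLeast0AtMost fps_of_poly_nth of_real_sum of_real_mult)
  have "eventually (\<lambda>z. z \<in> eball 0 (fps_conv_radius ?F)) (nhds 0)"
    using F(1) by (intro eventually_nhds_in_open) (auto simp: zero_ereal_def)
  with F(2) have "eventually (\<lambda>z. (\<lambda>n. of_real (c n) * z ^ n) sums ((1 + poly ?p z) powr complex_of_real (- a))) (nhds 0)"
  proof eventually_elim
    case (elim z)
    thus ?case using sums_eval_fps[of z ?F] unfolding nth by simp
  qed
  moreover have "filterlim complex_of_real (nhds 0) (nhds 0)"
    using tendsto_of_real[OF filterlim_ident[of "nhds (0::real)"], where 'a = complex] by simp
  ultimately have "eventually (\<lambda>t. (\<lambda>n. complex_of_real (c n) * of_real t ^ n) sums ((1 + poly ?p (of_real t)) powr complex_of_real (- a))) (nhds (0::real))"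
    by (rule eventually_compose_filterlim)
  with eventually_gf_base_pos[of x]
  have "eventually (\<lambda>t. (\<lambda>n. c n * t ^ n) sums ((1 - 2 * x * t + t ^ 2) powr (- a))) (nhds (0::real))"
  proof eventually_elim
    case (elim t)
    have "1 + poly ?p (of_real t) = of_real (1 - 2 * x * t + t ^ 2)"
      by (simp add: algebra_simps power2_eq_square)
    hence "(1 + poly ?p (of_real t)) powr complex_of_real (- a) = of_real ((1 - 2 * x * t + t ^ 2) powr (- a))"
      using elim(1) by (simp only: powr_of_real less_imp_le)
    with elim(2) show ?case
      by (simp only: of_real_mult[symmetric] of_real_power[symmetric] sums_of_real_iff)
  qed
  hence "(\<lambda>t. (1 - 2 * x * t + t ^ 2) powr (- a)) has_fps_expansion Abs_fps c"
    by (intro has_fps_expansionI) simp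
  from higher_deriv_0_has_fps_expansion[OF this, of k] show ?thesis
    by (simp add: gegen_gf_def c_def)
qed

text \<open>The coefficient of x^(k-2s) in the polynomial. The prefactor \<open>g_kd k d\<close> is
  what makes one formula serve both families: k/2 for Chebyshev, 1/Gamma((d-1)/2) for
  Gegenbauer.\<close>

definition geg_coef :: "nat \<Rightarrow> nat \<Rightarrow> nat \<Rightarrow> real" where
  "geg_coef d k s = g_kd k d * (-1) ^ s * 2 ^ (k - 2 * s) * Gamma ((real d - 1) / 2 + real k - real s)
     / (fact s * fact (k - 2 * s))"

lemma sum_half_reindex:
  fixes h :: "nat \<Rightarrow> 'a::comm_monoid_add"
  shows "(\<Sum>i\<le>k. if k \<le> 2 * i then h i else 0) = (\<Sum>s\<le>k div 2. h (k - s))"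
proof -
  have "(\<Sum>i\<le>k. if k \<le> 2 * i then h i else 0) = (\<Sum>i\<in>{i. i \<le> k \<and> k \<le> 2 * i}. h i)"
    by (rule sum.mono_neutral_cong_right) auto
  also have "\<dots> = (\<Sum>s\<le>k div 2. h (k - s))"
    by (rule sum.reindex_bij_witness[of _ "\<lambda>s. k - s" "\<lambda>s. k - s"]) auto
  finally show ?thesis .
qed

lemma pos_notin_nonpos_Ints: "x > 0 \<Longrightarrow> x \<notin> \<int>\<^sub>\<le>\<^sub>0" for x :: real
  using nonpos_Ints_nonpos[of x] by linarith

text \<open>Substituting i = k - s in the composed series turns the generalized binomial coefficient
  into a Gamma quotient. The signs combine because (k-s) + (k-2s) has the parity of s.\<close>

lemma gegen_gf_explicit:
  assumes "a > 0"
  shows "gegen_gf a k x = (\<Sum>s\<le>k div 2. (-1) ^ s * 2 ^ (k - 2 * s) * Gamma (a + real k - real s)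
     / (Gamma a * fact s * fact (k - 2 * s)) * x ^ (k - 2 * s))"
proof -
  have "gegen_gf a k x = (\<Sum>i\<le>k. if k \<le> 2 * i then (- a gchoose i) * (real (i choose (k - i)) * (- 2 * x) ^ (2 * i - k)) else 0)"
    unfolding gegen_gf_sum coeff_X_mult_linear_power by (intro sum.cong refl) simp
  also have "\<dots> = (\<Sum>s\<le>k div 2. (- a gchoose (k - s)) * (real (k - s choose (k - (k - s))) * (- 2 * x) ^ (2 * (k - s) - k)))"
    by (rule sum_half_reindex)
  also have "\<dots> = (\<Sum>s\<le>k div 2. (-1) ^ s * 2 ^ (k - 2 * s) * Gamma (a + real k - real s)
     / (Gamma a * fact s * fact (k - 2 * s)) * x ^ (k - 2 * s))"
  proof (intro sum.cong refl)
    fix s assume "s \<in> {..k div 2}"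
    hence s: "2 * s \<le> k" by auto
    have "a \<notin> \<int>\<^sub>\<le>\<^sub>0" using assms by (intro pos_notin_nonpos_Ints) simp
    hence 1: "(- a gchoose (k - s)) = (-1) ^ (k - s) * (Gamma (a + real k - real s) / Gamma a) / fact (k - s)"
      using s by (simp add: gbinomial_pochhammer pochhammer_Gamma of_nat_diff algebra_simps)
    have 2: "real (k - s choose (k - (k - s))) = fact (k - s) / (fact s * fact (k - 2 * s))"
      using s by (subst binomial_fact) (auto simp: mult_2)
    have e: "2 * (k - s) - k = k - 2 * s" "k - s = (k - 2 * s) + s"
      using s by auto
    have 3: "(- 2 * x) ^ (2 * (k - s) - k) = (-1) ^ (k - 2 * s) * (2 ^ (k - 2 * s) * x ^ (k - 2 * s))"
      unfolding e(1) by (simp only: power_mult_distrib[symmetric]) simp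
    have "(-1 :: real) ^ (k - s) * (-1) ^ (k - 2 * s) = (-1) ^ s"
      unfolding e(2) by (simp add: power_add flip: power_mult_distrib mult.assoc)
    hence 4: "(-1 :: real) ^ (k - s) * (-1) ^ (k - 2 * s) * z = (-1) ^ s * z" for z
      by simp
    have "(- a gchoose (k - s)) * (real (k - s choose (k - (k - s))) * (- 2 * x) ^ (2 * (k - s) - k)) =
        (-1) ^ (k - s) * (-1) ^ (k - 2 * s) * (2 ^ (k - 2 * s) * Gamma (a + real k - real s)
          / (Gamma a * fact s * fact (k - 2 * s)) * x ^ (k - 2 * s))"
      unfolding 1 2 3 by (simp add: mult_ac)
    thus "(- a gchoose (k - s)) * (real (k - s choose (k - (k - s))) * (- 2 * x) ^ (2 * (k - s) - k)) =
       (-1) ^ s * 2 ^ (k - 2 * s) * Gamma (a + real k - real s)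
     / (Gamma a * fact s * fact (k - 2 * s)) * x ^ (k - 2 * s)"
      unfolding 4 by (simp add: mult.assoc)
  qed
  finally show ?thesis .
qed

text \<open>At x = 1 the base is the square (1-t)^2, so the generating function is itself a binomial
  series with exponent -2a.\<close>

lemma gegen_gf_at_1: 
  assumes "a > 0"
  shows "gegen_gf a k 1 = Gamma (2 * a + real k) / (Gamma (2 * a) * fact k)"
proof -
  let ?F = "Abs_fps (\<lambda>n. (- (2 * a) gchoose n) * (-1) ^ n)"
  have "eventually (\<lambda>t. t \<in> {-1<..<1}) (nhds (0::real))"
    by (intro eventually_nhds_in_open) auto
  hence "eventually (\<lambda>t. (\<lambda>n. fps_nth ?F n * t ^ n) sums ((1 - 2 * 1 * t + t ^ 2) powr (- a))) (nhds (0::real))"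
  proof eventually_elim
    case (elim t)
    have "(\<lambda>n. (- (2 * a) gchoose n) * (- t) ^ n) sums (1 + (- t)) powr (- (2 * a))"
      using elim by (intro gen_binomial_real) auto
    moreover have "(1 - 2 * 1 * t + t ^ 2) powr (- a) = (1 + (- t)) powr (- (2 * a))"
    proof -
      have "1 - 2 * 1 * t + t ^ 2 = (1 + (- t)) powr 2"
        using elim by (simp add: power2_eq_square algebra_simps)
      thus ?thesis by (simp add: powr_powr)
    qed
    ultimately show ?case by (simp add: power_minus[of t] mult.assoc)
  qed
  hence "(\<lambda>t. (1 - 2 * 1 * t + t ^ 2) powr (- a)) has_fps_expansion ?F"
    by (rule has_fps_expansionI)
  from higher_deriv_0_has_fps_expansion[OF this, of k]
  have "gegen_gf a k 1 = (- (2 * a) gchoose k) * (-1) ^ k"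
    by (simp add: gegen_gf_def)
  moreover have "2 * a \<notin> \<int>\<^sub>\<le>\<^sub>0" using assms by (intro pos_notin_nonpos_Ints) simp
  ultimately show ?thesis
    by (simp add: gbinomial_pochhammer pochhammer_Gamma)
qed

section \<open>Chebyshev polynomials by the three-term recurrence\<close>

text \<open>Cutting off to 0 for 2s > k lets every sum run over s \<le> k, so the recurrence can be
  compared termwise without splitting on the parity of k.\<close>

definition cheb_coef :: "nat \<Rightarrow> nat \<Rightarrow> real" where
  "cheb_coef k s = (if 2 * s \<le> k then real k / 2 * (-1) ^ s * 2 ^ (k - 2 * s) * fact (k - s - 1)
     / (fact s * fact (k - 2 * s)) else 0)"

lemma cheb_coef_0: "cheb_coef (Suc k) 0 = 2 ^ k"
  by (simp add: cheb_coef_def divide_simps)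

lemma cheb_coef_diag:
  assumes "s \<ge> 1"
  shows "cheb_coef (2 * s) s = (-1) ^ s"
proof -
  obtain s' where "s = Suc s'" using assms by (cases s) auto
  thus ?thesis by (simp add: cheb_coef_def divide_simps)
qed

text \<open>This is T_(k+2) = 2x T_(k+1) - T_k read off at the coefficient with index s + 1.\<close>

lemma cheb_coef_Suc: 
  assumes "k \<ge> 1"
  shows "cheb_coef (Suc (Suc k)) (Suc s) = 2 * cheb_coef (Suc k) (Suc s) - cheb_coef k s"
proof -
  \<comment> \<open>At the boundary k = 2s the middle coefficient is already cut off, and the two
    diagonal values (-1)^s and (-1)^(s+1) balance; strictly inside, all three are multiples of one
    common product.\<close>
  consider "2 * s > k" | "2 * s = k" | r where "k = 2 * s + Suc r"
    by (metis add_Suc_right less_imp_Suc_add linorder_neqE_nat)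
  thus ?thesis
  proof cases
    case 1
    thus ?thesis by (simp add: cheb_coef_def)
  next
    case 2
    hence "cheb_coef k s = (-1) ^ s" "cheb_coef (Suc (Suc k)) (Suc s) = (-1) ^ Suc s"
      using cheb_coef_diag[of s] cheb_coef_diag[of "Suc s"] assms by (auto simp del: power_Suc)
    thus ?thesis using 2 by (simp add: cheb_coef_def[of "Suc k" "Suc s"])
  next
    case 3
    define P where "P = (-1) ^ s * 2 ^ r * (fact (s + r) :: real)"
    have e1: "cheb_coef (Suc (Suc k)) (Suc s) = - real (2 * s + r + 3) * (real (s + r + 1) * (2 * P)) / (fact (Suc s) * fact (Suc r)) / 2"
      unfolding 3 by (simp add: cheb_coef_def P_def add_ac) (simp add: field_simps, simp add: minus_divide_left algebra_simps)
    have e2: "cheb_coef (Suc k) (Suc s) = - real (2 * s + r + 2) * P / (fact (Suc s) * fact r) / 2"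
      unfolding 3 by (simp add: cheb_coef_def P_def add_ac) (simp add: field_simps, simp add: minus_divide_left algebra_simps)
    have e3: "cheb_coef k s = real (2 * s + r + 1) * 2 * P / (fact s * fact (Suc r)) / 2"
      unfolding 3 by (simp add: cheb_coef_def P_def mult_ac add_ac del: fact_Suc) (simp add: field_simps del: fact_Suc)
    show ?thesis
      unfolding e1 e2 e3 fact_Suc
      by (simp add: divide_simps del: of_nat_Suc) (simp add: algebra_simps)
  qed
qed

lemma cos_multiple_cheb:
  "k \<ge> 1 \<Longrightarrow> cos (real k * \<theta>) = (\<Sum>s\<le>k. cheb_coef k s * cos \<theta> ^ (k - 2 * s))"
proof (induction k rule: induct_nat_012)
  case 0
  thus ?case by simp
next
  case 1
  show ?case by (simp add: cheb_coef_def)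
next
  case (ge2 k)
  let ?x = "cos \<theta>"
  show ?case
  proof (cases "k = 0")
    \<comment> \<open>The prefactor k/2 makes \<open>cheb_coef 0 0\<close> equal to 0 instead of 1,
      so the recurrence cannot start at T_0 and T_2 is verified directly.\<close>
    case True
    have "(\<Sum>s\<le>Suc (Suc 0). cheb_coef (Suc (Suc 0)) s * ?x ^ (Suc (Suc 0) - 2 * s)) = 2 * ?x ^ 2 - 1"
      by (simp add: cheb_coef_def power2_eq_square)
    thus ?thesis using True by (simp add: cos_double_cos)
  next
    case False
    hence k: "k \<ge> 1" by simp
    have low: "cheb_coef k (Suc k) = 0" using k by (simp add: cheb_coef_def)
    have step: "cheb_coef (Suc k) s * ?x ^ (Suc (Suc k) - 2 * s) = ?x * (cheb_coef (Suc k) s * ?x ^ (Suc k - 2 * s))" for s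
    proof (cases "2 * s \<le> Suc k")
      case True
      hence "Suc (Suc k) - 2 * s = Suc (Suc k - 2 * s)" by auto
      thus ?thesis by simp
    qed (simp add: cheb_coef_def)
    have "(\<Sum>s\<le>Suc (Suc k). cheb_coef (Suc (Suc k)) s * ?x ^ (Suc (Suc k) - 2 * s)) =
       2 * cheb_coef (Suc k) 0 * ?x ^ Suc (Suc k) +
       (\<Sum>s\<le>Suc k. (2 * cheb_coef (Suc k) (Suc s) - cheb_coef k s) * ?x ^ (Suc (Suc k) - 2 * Suc s))"
      using k by (subst sum.atMost_Suc_shift) (simp add: cheb_coef_0 cheb_coef_Suc)
    also have "\<dots> = 2 * (cheb_coef (Suc k) 0 * ?x ^ (Suc (Suc k) - 2 * 0) + (\<Sum>s\<le>Suc k. cheb_coef (Suc k) (Suc s) * ?x ^ (Suc (Suc k) - 2 * Suc s)))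
        - (\<Sum>s\<le>Suc k. cheb_coef k s * ?x ^ (k - 2 * s))"
      by (simp add: left_diff_distrib sum_subtractf sum_distrib_left mult.assoc del: sum.atMost_Suc)
    also have "cheb_coef (Suc k) 0 * ?x ^ (Suc (Suc k) - 2 * 0) + (\<Sum>s\<le>Suc k. cheb_coef (Suc k) (Suc s) * ?x ^ (Suc (Suc k) - 2 * Suc s))
       = (\<Sum>s\<le>Suc (Suc k). cheb_coef (Suc k) s * ?x ^ (Suc (Suc k) - 2 * s))"
      by (rule sum.atMost_Suc_shift[symmetric])
    also have "\<dots> = ?x * (\<Sum>s\<le>Suc (Suc k). cheb_coef (Suc k) s * ?x ^ (Suc k - 2 * s))"
      by (simp only: step sum_distrib_left)
    also have "(\<Sum>s\<le>Suc (Suc k). cheb_coef (Suc k) s * ?x ^ (Suc k - 2 * s)) = cos (real (Suc k) * \<theta>)"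
      using ge2(2) by (subst sum.atMost_Suc) (simp add: cheb_coef_def)
    also have "(\<Sum>s\<le>Suc k. cheb_coef k s * ?x ^ (k - 2 * s)) = cos (real k * \<theta>)"
      using ge2(1)[OF k] low by simp
    also have "2 * (?x * cos (real (Suc k) * \<theta>)) - cos (real k * \<theta>) = cos (real (Suc (Suc k)) * \<theta>)"
    proof -
      have "real (Suc (Suc k)) * \<theta> = real (Suc k) * \<theta> + \<theta>" "real k * \<theta> = real (Suc k) * \<theta> - \<theta>"
        by (simp_all add: algebra_simps)
      thus ?thesis by (simp only: cos_add cos_diff) simp
    qed
    finally show ?thesis ..
  qed
qed

lemma geg_coef_1:
  assumes "k \<ge> 1" "2 * s \<le> k"
  shows "geg_coef 1 k s = cheb_coef k s"
proof -
  have "real k - real s = 1 + real (k - s - 1)"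
    using assms by (simp add: of_nat_diff)
  hence "Gamma (real k - real s) = fact (k - s - 1)"
    by (simp only: Gamma_fact)
  thus ?thesis using assms by (simp add: geg_coef_def cheb_coef_def g_kd_def)
qed

text \<open>The bound on x is what makes \<open>cos (arccos x) = x\<close> available on the
  circle.\<close>

lemma gegen_explicit:
  assumes "d \<ge> 1" "k \<ge> 1" "\<bar>x\<bar> \<le> 1"
  shows "gegen d k x = (\<Sum>s\<le>k div 2. geg_coef d k s * x ^ (k - 2 * s))"
proof (cases "d = 1")
  case True
  have "gegen d k x = (\<Sum>s\<le>k. cheb_coef k s * x ^ (k - 2 * s))"
    using cos_multiple_cheb[of k "arccos x"] assms True by (simp add: gegen_def)
  also have "\<dots> = (\<Sum>s\<le>k div 2. geg_coef 1 k s * x ^ (k - 2 * s))"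
    using assms by (intro sum.mono_neutral_cong_right) (auto simp: geg_coef_1[simplified] cheb_coef_def)
  finally show ?thesis using True by simp
next
  case False
  hence "gegen d k x = gegen_gf ((real d - 1) / 2) k x" by (simp add: gegen_def)
  also have "\<dots> = (\<Sum>s\<le>k div 2. geg_coef d k s * x ^ (k - 2 * s))"
    using False assms by (subst gegen_gf_explicit) (auto simp: geg_coef_def g_kd_def intro!: sum.cong)
  finally show ?thesis .
qed

section \<open>Contraction and polarization of symmetric tensors\<close>

text \<open>The homogeneous polynomial of degree m attached to T, that is T paired with the m-fold
  tensor power of v.\<close>

definition contract :: "nat \<Rightarrow> 'n::finite tensor \<Rightarrow> real^'n \<Rightarrow> real" where
  "contract m T v = (\<Sum>is | length is = m. T is * tpow v is)"

text \<open>The action of position permutations on multi-indices, in exactly the form used inside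
  \<open>tsym\<close>.\<close>

definition reindex_list :: "nat \<Rightarrow> (nat \<Rightarrow> nat) \<Rightarrow> 'a list \<Rightarrow> 'a list" where
  "reindex_list m \<sigma> is = map (\<lambda>l. is ! \<sigma> l) [0..<m]"

definition symmetric_tensor :: "nat \<Rightarrow> 'n tensor \<Rightarrow> bool" where
  "symmetric_tensor m T \<longleftrightarrow>
     (\<forall>\<sigma> is. \<sigma> permutes {..<m} \<longrightarrow> length is = m \<longrightarrow> T (reindex_list m \<sigma> is) = T is)"

lemma finite_lists_length: "finite {is :: 'n::finite list. length is = m}"
  using finite_lists_length_eq[of "UNIV :: 'n set" m] by simp

lemma tpow_append: "tpow v (xs @ ys) = tpow v xs * tpow v ys"
  by (simp add: tpow_def)

lemma tpow_conv_prod: "tpow v is = (\<Prod>l<length is. v $ (is ! l))"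
  by (simp add: tpow_def prod.list_conv_set_nth atLeast0LessThan)

lemma sum_lists_append:
  fixes f :: "'n::finite list \<Rightarrow> real"
  shows "(\<Sum>is | length is = p + q. f is) = (\<Sum>xs | length xs = p. \<Sum>ys | length ys = q. f (xs @ ys))"
proof -
  have "(\<Sum>is | length is = p + q. f is) =
      (\<Sum>(xs, ys) \<in> {xs. length xs = p} \<times> {ys. length ys = q}. f (xs @ ys))"
    by (rule sum.reindex_bij_witness[of _ "\<lambda>(xs, ys). xs @ ys" "\<lambda>is. (take p is, drop p is)"]) auto
  thus ?thesis by (simp add: sum.cartesian_product)
qed

text \<open>Cutting a multi-index at position p factors its weight \<open>tpow v\<close>, so
  Kronecker products become products of polynomials in v.\<close>

lemma contract_tkron: "contract (p + q) (tkron p A B) v = contract p A v * contract q B v"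
proof -
  have "contract (p + q) (tkron p A B) v =
      (\<Sum>xs | length xs = p. \<Sum>ys | length ys = q. (A xs * tpow v xs) * (B ys * tpow v ys))"
    unfolding contract_def sum_lists_append
    by (intro sum.cong refl) (simp add: tkron_def tpow_append)
  thus ?thesis by (simp add: contract_def sum_product)
qed

lemma contract_sum: "contract m (\<lambda>is. \<Sum>j\<in>A. c j * T j is) v = (\<Sum>j\<in>A. c j * contract m (T j) v)"
  unfolding contract_def sum_distrib_right sum_distrib_left
  by (subst sum.swap) (simp add: mult.assoc)

lemma contract_diff: "contract m (\<lambda>is. T is - T' is) v = contract m T v - contract m T' v"
  by (simp add: contract_def left_diff_distrib sum_subtractf)

lemma contract_0: "contract 0 T v = T []"
proof -
  have "{is :: 'a list. length is = 0} = {[]}" by auto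
  thus ?thesis by (simp add: contract_def tpow_def)
qed

lemma tpowT_Suc: "tpowT p T (Suc j) = tkron p T (tpowT p T j)"
proof
  fix "is" :: "'a list"
  have "drop (Suc l * p) is = drop (l * p) (drop p is)" for l
    by (simp add: add.commute)
  thus "tpowT p T (Suc j) is = tkron p T (tpowT p T j) is"
    by (simp add: tpowT_def tkron_def prod.lessThan_Suc_shift del: prod.lessThan_Suc mult_Suc)
qed

lemma contract_tpowT: "contract (p * j) (tpowT p T j) v = contract p T v ^ j"
proof (induction j)
  case 0
  show ?case by (simp add: contract_0 tpowT_def)
next
  case (Suc j)
  thus ?case by (simp add: tpowT_Suc contract_tkron)
qed

lemma sum_lists_1:
  fixes f :: "'n::finite list \<Rightarrow> real"
  shows "(\<Sum>is | length is = Suc 0. f is) = (\<Sum>i\<in>UNIV. f [i])"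
  by (rule sum.reindex_bij_witness[of _ "\<lambda>i. [i]" hd]) (auto simp: length_Suc_conv)

lemma contract_tpow: "contract m (tpow \<mu>) v = (v \<bullet> \<mu>) ^ m"
proof (induction m)
  case 0
  show ?case by (simp add: contract_0 tpow_def)
next
  case (Suc m)
  have "tpow \<mu> = tkron 1 (tpow \<mu>) (tpow \<mu>)"
    by (simp add: fun_eq_iff tkron_def flip: tpow_append)
  hence "contract (1 + m) (tpow \<mu>) v = contract 1 (tpow \<mu>) v * (v \<bullet> \<mu>) ^ m"
    using contract_tkron[of 1 m "tpow \<mu>" "tpow \<mu>" v] Suc by simp
  also have "contract 1 (tpow \<mu>) v = v \<bullet> \<mu>"
    by (simp add: contract_def sum_lists_1 tpow_def inner_vec_def mult.commute)
  finally show ?case by simp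
qed

lemma contract_vecI: "contract 2 vecI v = v \<bullet> v"
proof -
  have "contract (1 + 1) vecI v = (\<Sum>i\<in>UNIV. \<Sum>j\<in>UNIV. if i = j then v $ i * v $ j else 0)"
    unfolding contract_def sum_lists_append
    by (simp add: sum_lists_1 vecI_def tpow_def if_distrib[of "\<lambda>z. z * _"] cong: if_cong)
  also have "\<dots> = v \<bullet> v" by (simp add: inner_vec_def)
  finally show ?thesis by (simp add: numeral_2_eq_2)
qed

lemma length_reindex_list [simp]: "length (reindex_list m \<sigma> is) = m"
  by (simp add: reindex_list_def)

lemma nth_reindex_list [simp]: "l < m \<Longrightarrow> reindex_list m \<sigma> is ! l = is ! \<sigma> l"
  by (simp add: reindex_list_def)

lemma permutes_lessThan: "\<sigma> permutes {..<m} \<Longrightarrow> \<sigma> l < m \<longleftrightarrow> l < m"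
  using permutes_in_image[of \<sigma> "{..<m}" l] by simp

lemma reindex_list_compose:
  assumes "\<sigma> permutes {..<m}"
  shows "reindex_list m \<sigma> (reindex_list m \<tau> is) = reindex_list m (\<tau> \<circ> \<sigma>) is"
  using assms by (intro nth_equalityI) (auto simp: permutes_lessThan)

lemma reindex_list_id: "length is = m \<Longrightarrow> reindex_list m id is = is"
  by (intro nth_equalityI) auto

lemma tpow_reindex_list:
  assumes "\<sigma> permutes {..<m}" "length is = m"
  shows "tpow v (reindex_list m \<sigma> is) = tpow v is"
proof -
  have "tpow v (reindex_list m \<sigma> is) = (\<Prod>l<m. v $ (is ! \<sigma> l))"
    by (simp add: tpow_conv_prod)
  also have "\<dots> = (\<Prod>l<m. v $ (is ! l))"
    using prod.permute[OF assms(1), of "\<lambda>l. v $ (is ! l)"] by (simp add: o_def)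
  finally show ?thesis using assms by (simp add: tpow_conv_prod)
qed

lemma tsym_conv: "tsym m T is = (\<Sum>\<sigma> | \<sigma> permutes {..<m}. T (reindex_list m \<sigma> is)) / fact m"
  by (simp add: tsym_def reindex_list_def)

text \<open>Permuting the positions leaves the weight \<open>tpow v\<close> unchanged, so each of
  the m! summands of the symmetrizer contributes the same value. After contraction the symmetrizer
  disappears from every formula.\<close>

lemma contract_tsym: "contract m (tsym m T) v = contract m T v"
proof -
  have "(\<Sum>is | length is = m. T (reindex_list m \<sigma> is) * tpow v is) = contract m T v"
    if \<sigma>: "\<sigma> permutes {..<m}" for \<sigma>
    unfolding contract_def
  proof (rule sum.reindex_bij_witness[of _ "reindex_list m (inv \<sigma>)" "reindex_list m \<sigma>"])
    fix "is" :: "'a list" assume "is \<in> {is. length is = m}"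
    hence l: "length is = m" by simp
    show "reindex_list m (inv \<sigma>) (reindex_list m \<sigma> is) = is"
      "reindex_list m \<sigma> (reindex_list m (inv \<sigma>) is) = is"
      using \<sigma> l permutes_inv[OF \<sigma>]
      by (simp_all add: reindex_list_compose permutes_inv_o reindex_list_id)
    show "T (reindex_list m \<sigma> is) * tpow v (reindex_list m \<sigma> is) = T (reindex_list m \<sigma> is) * tpow v is"
      by (simp add: tpow_reindex_list[OF \<sigma> l])
  qed auto
  hence "(\<Sum>\<sigma> | \<sigma> permutes {..<m}. \<Sum>is | length is = m. T (reindex_list m \<sigma> is) * tpow v is) =
      fact m * contract m T v"
    by (simp add: card_permutations)
  moreover have "contract m (tsym m T) v =
     (\<Sum>\<sigma> | \<sigma> permutes {..<m}. \<Sum>is | length is = m. T (reindex_list m \<sigma> is) * tpow v is) / fact m"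
    unfolding contract_def tsym_conv
    by (subst sum.swap) (simp add: sum_divide_distrib sum_distrib_right)
  ultimately show ?thesis by simp
qed

lemma symmetric_tsym: "symmetric_tensor m (tsym m T)"
  unfolding symmetric_tensor_def
proof (intro allI impI)
  fix \<tau> and "is" :: "'a list" assume \<tau>: "\<tau> permutes {..<m}" and l: "length is = m"
  have "(\<Sum>\<sigma> | \<sigma> permutes {..<m}. T (reindex_list m \<sigma> is)) =
      (\<Sum>\<sigma> | \<sigma> permutes {..<m}. T (reindex_list m \<sigma> (reindex_list m \<tau> is)))"
    by (subst setum_permutations_compose_left[OF \<tau>]) (simp add: reindex_list_compose)
  thus "tsym m T (reindex_list m \<tau> is) = tsym m T is" by (simp add: tsym_conv)
qed

section \<open>The polarization identity\<close>

text \<open>Expand the product of 1 - 1 over B - A; a subset X of B - A corresponds to the superset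
  S = B - X of A.\<close>

lemma sum_alternating_supersets:
  assumes "finite B" "A \<subseteq> B"
  shows "(\<Sum>S | A \<subseteq> S \<and> S \<subseteq> B. (-1) ^ card (B - S)) = (if A = B then 1 else (0::real))"
proof -
  have "(\<Prod>x\<in>B - A. 1 - (1::real)) = (\<Sum>X\<in>Pow (B - A). (-1) ^ card X * (\<Prod>x\<in>X. 1) * (\<Prod>x\<in>B - A - X. 1))"
    using assms by (intro prod_diff_conv_sum) auto
  also have "\<dots> = (\<Sum>S | A \<subseteq> S \<and> S \<subseteq> B. (-1) ^ card (B - S))"
  proof (rule sum.reindex_bij_witness[of _ "\<lambda>S. B - S" "\<lambda>X. B - X"])
    fix X assume "X \<in> Pow (B - A)"
    thus "B - (B - X) = X" "B - X \<in> {S. A \<subseteq> S \<and> S \<subseteq> B}"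
      using assms by auto
    hence "B - (B - X) = X" by blast
    thus "(-1) ^ card (B - (B - X)) = (-1) ^ card X * (\<Prod>x\<in>X. 1) * (\<Prod>x\<in>B - A - X. 1 :: real)"
      by simp
  qed auto
  finally have "(\<Sum>S | A \<subseteq> S \<and> S \<subseteq> B. (-1) ^ card (B - S)) = (0::real) ^ card (B - A)"
    by simp
  moreover have "card (B - A) > 0" if "A \<noteq> B"
    using assms that by (auto simp: card_gt_0_iff)
  ultimately show ?thesis by (cases "A = B") (auto simp: power_0_left)
qed

text \<open>Each position l independently picks one of the unit vectors indexed by S; expanding the
  product of these sums indexes the terms by maps from positions to S.\<close>

lemma contract_sum_axis:
  fixes T :: "'n::finite tensor"
  assumes S: "S \<subseteq> {..<m}" and l: "length is = m"
  shows "contract m T (\<Sum>q\<in>S. axis (is ! q) 1) =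
    (\<Sum>\<phi>\<in>{..<m} \<rightarrow>\<^sub>E S. T (reindex_list m \<phi> is))"
proof -
  have fin: "finite S" using S finite_subset by blast
  have tp: "tpow (\<Sum>q\<in>S. axis (is ! q) 1) js =
     (\<Sum>\<phi>\<in>{..<m} \<rightarrow>\<^sub>E S. if js = reindex_list m \<phi> is then 1 else 0)" if "length js = m" for js
  proof -
    have "tpow (\<Sum>q\<in>S. axis (is ! q) 1) js = (\<Prod>l<m. \<Sum>q\<in>S. if is ! q = js ! l then 1 else 0)"
      using that by (simp add: tpow_conv_prod axis_def eq_commute)
    also have "\<dots> = (\<Sum>\<phi>\<in>{..<m} \<rightarrow>\<^sub>E S. \<Prod>l<m. if is ! \<phi> l = js ! l then 1 else 0)"
      using fin by (intro prod_sum_PiE) auto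
    also have "\<dots> = (\<Sum>\<phi>\<in>{..<m} \<rightarrow>\<^sub>E S. if js = reindex_list m \<phi> is then 1 else 0)"
    proof (intro sum.cong refl)
      fix \<phi>
      have "js = reindex_list m \<phi> is \<longleftrightarrow> (\<forall>l<m. is ! \<phi> l = js ! l)"
        using that by (auto simp: list_eq_iff_nth_eq)
      thus "(\<Prod>l<m. if is ! \<phi> l = js ! l then 1 else 0) = (if js = reindex_list m \<phi> is then 1 else (0::real))"
        by (auto intro!: prod.neutral prod_zero)
    qed
    finally show ?thesis .
  qed
  have "contract m T (\<Sum>q\<in>S. axis (is ! q) 1) =
     (\<Sum>js | length js = m. \<Sum>\<phi>\<in>{..<m} \<rightarrow>\<^sub>E S. if js = reindex_list m \<phi> is then T js else 0)"
    unfolding contract_def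
    by (intro sum.cong refl) (simp add: tp sum_distrib_left if_distrib cong: if_cong)
  also have "\<dots> = (\<Sum>\<phi>\<in>{..<m} \<rightarrow>\<^sub>E S. T (reindex_list m \<phi> is))"
    by (subst sum.swap) (simp add: finite_lists_length)
  finally show ?thesis .
qed

text \<open>Polarization: the alternating sum over the subsets of positions keeps exactly the
  surjective, hence bijective, maps among the positions.\<close>

lemma polarization:
  fixes T :: "'n::finite tensor"
  assumes sym: "symmetric_tensor m T" and l: "length is = m"
  shows "fact m * T is = (\<Sum>S\<in>Pow {..<m}. (-1) ^ card ({..<m} - S) * contract m T (\<Sum>q\<in>S. axis (is ! q) 1))"
proof -
  let ?B = "{..<m}" and ?F = "\<lambda>\<phi>. T (reindex_list m \<phi> is)"
  have "(\<Sum>S\<in>Pow ?B. (-1) ^ card (?B - S) * contract m T (\<Sum>q\<in>S. axis (is ! q) 1)) =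
     (\<Sum>S\<in>Pow ?B. \<Sum>\<phi>\<in>?B \<rightarrow>\<^sub>E ?B. if \<phi> ` ?B \<subseteq> S then (-1) ^ card (?B - S) * ?F \<phi> else 0)"
  proof (intro sum.cong refl)
    fix S assume S: "S \<in> Pow ?B"
    have "(\<Sum>\<phi>\<in>?B \<rightarrow>\<^sub>E S. (-1) ^ card (?B - S) * ?F \<phi>) =
       (\<Sum>\<phi>\<in>?B \<rightarrow>\<^sub>E ?B. if \<phi> ` ?B \<subseteq> S then (-1) ^ card (?B - S) * ?F \<phi> else 0)"
      using S by (intro sum.mono_neutral_cong_left finite_PiE) (auto simp: PiE_iff)
    thus "(-1) ^ card (?B - S) * contract m T (\<Sum>q\<in>S. axis (is ! q) 1) =
       (\<Sum>\<phi>\<in>?B \<rightarrow>\<^sub>E ?B. if \<phi> ` ?B \<subseteq> S then (-1) ^ card (?B - S) * ?F \<phi> else 0)"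
      using S by (simp add: contract_sum_axis[OF _ l] sum_distrib_left)
  qed
  also have "\<dots> = (\<Sum>\<phi>\<in>?B \<rightarrow>\<^sub>E ?B. \<Sum>S\<in>Pow ?B. if \<phi> ` ?B \<subseteq> S then (-1) ^ card (?B - S) * ?F \<phi> else 0)"
    by (rule sum.swap)
  also have "\<dots> = (\<Sum>\<phi>\<in>?B \<rightarrow>\<^sub>E ?B. (\<Sum>S | \<phi> ` ?B \<subseteq> S \<and> S \<subseteq> ?B. (-1) ^ card (?B - S)) * ?F \<phi>)"
    by (intro sum.cong refl, subst sum.inter_filter[symmetric])
       (auto simp: sum_distrib_right intro!: sum.cong)
  also have "\<dots> = (\<Sum>\<phi>\<in>?B \<rightarrow>\<^sub>E ?B. if \<phi> ` ?B = ?B then ?F \<phi> else 0)"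
    by (intro sum.cong refl, subst sum_alternating_supersets) auto
  also have "\<dots> = (\<Sum>\<phi> | \<phi> \<in> ?B \<rightarrow>\<^sub>E ?B \<and> \<phi> ` ?B = ?B. ?F \<phi>)"
    by (subst sum.inter_filter[symmetric]) (auto intro!: finite_PiE)
  also have "\<dots> = (\<Sum>\<sigma> | \<sigma> permutes ?B. T is)"
  \<comment> \<open>A permutation is the identity outside the positions while an extensional map is
    \<open>undefined\<close> there; extension and restriction translate between the two
    encodings.\<close>
  proof (rule sum.reindex_bij_witness[of _ "\<lambda>\<sigma>. restrict \<sigma> ?B" "\<lambda>\<phi> l. if l < m then \<phi> l else l"])
    fix \<phi> assume \<phi>: "\<phi> \<in> {\<phi>. \<phi> \<in> ?B \<rightarrow>\<^sub>E ?B \<and> \<phi> ` ?B = ?B}"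
    show "restrict (\<lambda>l. if l < m then \<phi> l else l) ?B = \<phi>"
      using \<phi> by (auto simp: PiE_iff extensional_def restrict_def fun_eq_iff)
    have "inj_on \<phi> ?B" using \<phi> by (intro eq_card_imp_inj_on) auto
    hence "bij_betw \<phi> ?B ?B" using \<phi> by (simp add: bij_betw_def)
    hence "bij_betw (\<lambda>l. if l < m then \<phi> l else l) ?B ?B"
      by (rule bij_betw_cong[THEN iffD1, rotated]) simp
    hence "(\<lambda>l. if l < m then \<phi> l else l) permutes ?B"
      by (rule bij_imp_permutes) simp
    thus "(\<lambda>l. if l < m then \<phi> l else l) \<in> {\<sigma>. \<sigma> permutes ?B}" by simp
    moreover have "reindex_list m (\<lambda>l. if l < m then \<phi> l else l) is = reindex_list m \<phi> is"
      by (simp add: reindex_list_def)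
    ultimately show "T is = T (reindex_list m \<phi> is)"
      using sym l unfolding symmetric_tensor_def by (metis mem_Collect_eq)
  next
    fix \<sigma> assume \<sigma>: "\<sigma> \<in> {\<sigma>. \<sigma> permutes ?B}"
    show "(\<lambda>l. if l < m then restrict \<sigma> ?B l else l) = \<sigma>"
      using \<sigma> by (auto simp: fun_eq_iff permutes_def)
    show "restrict \<sigma> ?B \<in> {\<phi>. \<phi> \<in> ?B \<rightarrow>\<^sub>E ?B \<and> \<phi> ` ?B = ?B}"
      using \<sigma> by (auto simp: permutes_lessThan permutes_image)
  qed
  also have "\<dots> = fact m * T is" by (simp add: card_permutations)
  finally show ?thesis ..
qed

lemma symmetric_tensor_eqI:
  fixes T :: "'n::finite tensor"
  assumes "symmetric_tensor m T" "symmetric_tensor m T'"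
    and "\<And>v. contract m T v = contract m T' v" "length is = m"
  shows "T is = T' is"
proof -
  have "fact m * T is = fact m * T' is"
    unfolding polarization[OF assms(1,4)] polarization[OF assms(2,4)] assms(3) ..
  thus ?thesis by simp
qed

section \<open>Orthogonal invariance of Lebesgue measure\<close>

text \<open>The library proves invariance under linear maps only for index types of class
  \<^class>\<open>wellorder\<close>; an arbitrary finite index type is replaced by a well-ordered copy.\<close>

typedef 'a ordered_copy = "UNIV :: 'a set" ..

lemma bij_Rep_ordered_copy: "bij Rep_ordered_copy"
  by (rule bij_betw_byWitness[where f' = Abs_ordered_copy])
     (auto simp: Rep_ordered_copy_inverse Abs_ordered_copy_inverse)

instance ordered_copy :: (finite) finite
proof
  show "finite (UNIV :: 'a ordered_copy set)"
    using bij_betw_finite[OF bij_Rep_ordered_copy[where 'a = 'a]] by simp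
qed

instantiation ordered_copy :: (finite) wellorder
begin

definition less_eq_ordered_copy :: "'a ordered_copy \<Rightarrow> 'a ordered_copy \<Rightarrow> bool" where
  "less_eq_ordered_copy x y \<longleftrightarrow> to_nat (Rep_ordered_copy x) \<le> to_nat (Rep_ordered_copy y)"

definition less_ordered_copy :: "'a ordered_copy \<Rightarrow> 'a ordered_copy \<Rightarrow> bool" where
  "less_ordered_copy x y \<longleftrightarrow> to_nat (Rep_ordered_copy x) < to_nat (Rep_ordered_copy y)"

instance
proof
  fix P :: "'a ordered_copy \<Rightarrow> bool" and a :: "'a ordered_copy"
  assume "\<And>x. (\<And>y. y < x \<Longrightarrow> P y) \<Longrightarrow> P x"
  thus "P a"
  proof (induction "to_nat (Rep_ordered_copy a)" arbitrary: a rule: less_induct)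
    case less
    show ?case
      by (rule less(2)) (rule less(1)[OF _ less(2)], simp_all add: less_ordered_copy_def)
  qed
qed (auto simp: less_eq_ordered_copy_def less_ordered_copy_def Rep_ordered_copy_inject)

end

lemma measurable_linear:
  fixes f :: "'a::euclidean_space \<Rightarrow> 'b::euclidean_space"
  assumes "linear f"
  shows "f \<in> borel_measurable borel"
proof -
  have "bounded_linear f" using assms by (rule linear_conv_bounded_linear[THEN iffD1])
  thus ?thesis by (intro borel_measurable_continuous_onI linear_continuous_on)
qed

lemma prod_Basis_cart:
  fixes f :: "real^'n::finite \<Rightarrow> 'a::comm_monoid_mult"
  shows "(\<Prod>b\<in>Basis. f b) = (\<Prod>i\<in>UNIV. f (axis i 1))"
proof -
  have B: "(Basis :: (real^'n) set) = (\<lambda>i. axis i 1) ` UNIV"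
    by (auto simp: Basis_vec_def)
  have inj: "inj (\<lambda>i::'n. axis i (1::real))"
    by (auto simp: inj_def axis_eq_axis)
  show ?thesis
    unfolding B by (subst prod.reindex[OF inj]) simp
qed

text \<open>Lebesgue measure is determined by its values on boxes, and the preimage of a box is its
  image under the inverse orthogonal map.\<close>

lemma lborel_orthogonal_wellorder:
  fixes f :: "real^'n::{finite,wellorder} \<Rightarrow> real^'n::_"
  assumes f: "orthogonal_transformation f"
  shows "distr lborel borel f = lborel"
proof (rule lborel_eqI[symmetric])
  fix l u :: "real^'n::_" assume le: "\<And>b. b \<in> Basis \<Longrightarrow> l \<bullet> b \<le> u \<bullet> b"
  have meas: "f \<in> borel_measurable borel"
    using f by (intro measurable_linear orthogonal_transformation_linear)
  have inv: "orthogonal_transformation (inv f)"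
    by (rule orthogonal_transformation_inv[OF f])
  have vim: "f -` box l u = inv f ` box l u"
    using orthogonal_transformation_bij[OF f] by (simp add: bij_vimage_eq_inv_image)
  have lm: "inv f ` box l u \<in> lmeasurable"
    by (rule measurable_orthogonal_image[OF inv]) simp
  have "emeasure (distr lborel borel f) (box l u) = emeasure lborel (f -` box l u)"
    using meas by (simp add: emeasure_distr)
  also have "\<dots> = emeasure lebesgue (f -` box l u)"
    using measurable_sets[OF meas, of "box l u"] by simp
  also have "\<dots> = ennreal (measure lebesgue (box l u))"
    unfolding vim using lm by (simp add: emeasure_eq_measure2 measure_orthogonal_image[OF inv])
  also have "\<dots> = emeasure lborel (box l u)"
    by (simp add: emeasure_eq_measure2)
  also have "\<dots> = (\<Prod>b\<in>Basis. (u - l) \<bullet> b)"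
    using le by (simp add: emeasure_lborel_box)
  finally show "emeasure (distr lborel borel f) (box l u) = (\<Prod>b\<in>Basis. (u - l) \<bullet> b)" .
qed simp

definition from_copy :: "real^('n::finite ordered_copy) \<Rightarrow> real^'n" where
  "from_copy y = (\<chi> i. y $ Abs_ordered_copy i)"

definition to_copy :: "real^'n::finite \<Rightarrow> real^('n ordered_copy)" where
  "to_copy x = (\<chi> i. x $ Rep_ordered_copy i)"

lemma from_to_copy [simp]: "from_copy (to_copy x) = x"
  by (simp add: from_copy_def to_copy_def Abs_ordered_copy_inverse)

lemma to_from_copy [simp]: "to_copy (from_copy y) = y"
  by (simp add: from_copy_def to_copy_def Rep_ordered_copy_inverse)

lemma inner_to_copy: "to_copy x \<bullet> to_copy y = x \<bullet> y"
  using sum.reindex_bij_betw[OF bij_Rep_ordered_copy, of "\<lambda>i. x $ i * y $ i"]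
  by (simp add: inner_vec_def to_copy_def)

lemma inner_from_copy: "from_copy x \<bullet> from_copy y = x \<bullet> y"
  using inner_to_copy[of "from_copy x" "from_copy y"] by simp

lemma linear_to_copy: "linear to_copy"
  by (rule linearI) (simp_all add: to_copy_def vec_eq_iff)

lemma linear_from_copy: "linear from_copy"
  by (rule linearI) (simp_all add: from_copy_def vec_eq_iff)

text \<open>Relabelling coordinates sends boxes to boxes with the same side lengths in another
  order.\<close>

lemma lborel_from_copy: "distr lborel borel (from_copy :: _ \<Rightarrow> real^'n::finite) = lborel"
proof (rule lborel_eqI[symmetric])
  fix l u :: "real^'n" assume le: "\<And>b. b \<in> Basis \<Longrightarrow> l \<bullet> b \<le> u \<bullet> b"
  have le': "l $ i \<le> u $ i" for i
    using le[of "axis i 1"] by (simp add: inner_axis)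
  have "from_copy -` box l u = box (to_copy l) (to_copy u)"
  proof -
    have "from_copy y \<in> box l u \<longleftrightarrow> y \<in> box (to_copy l) (to_copy u)" for y
    proof
      assume *: "from_copy y \<in> box l u"
      show "y \<in> box (to_copy l) (to_copy u)"
        unfolding mem_box_cart
      proof
        fix j :: "'n ordered_copy"
        show "to_copy l $ j < y $ j \<and> y $ j < to_copy u $ j"
          using *[unfolded mem_box_cart, rule_format, of "Rep_ordered_copy j"]
          by (simp add: from_copy_def to_copy_def Rep_ordered_copy_inverse)
      qed
    next
      assume *: "y \<in> box (to_copy l) (to_copy u)"
      show "from_copy y \<in> box l u"
        unfolding mem_box_cart
      proof
        fix i :: 'n
        show "l $ i < from_copy y $ i \<and> from_copy y $ i < u $ i"
          using *[unfolded mem_box_cart, rule_format, of "Abs_ordered_copy i"]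
          by (simp add: from_copy_def to_copy_def Abs_ordered_copy_inverse)
      qed
    qed
    thus ?thesis by auto
  qed
  hence "emeasure (distr lborel borel from_copy) (box l u) = emeasure lborel (box (to_copy l) (to_copy u))"
    using measurable_linear[OF linear_from_copy[where 'a = 'n]] by (simp add: emeasure_distr)
  also have "\<dots> = (\<Prod>b\<in>Basis. (to_copy u - to_copy l) \<bullet> b)"
    by (intro emeasure_lborel_box) (auto simp: Basis_vec_def inner_axis to_copy_def le')
  also have "(\<Prod>b\<in>Basis. (to_copy u - to_copy l) \<bullet> b) = (\<Prod>b\<in>Basis. (u - l) \<bullet> b)"
    using prod.reindex_bij_betw[OF bij_Rep_ordered_copy, of "\<lambda>i. u $ i - l $ i"]
    by (simp add: prod_Basis_cart inner_axis to_copy_def)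
  finally show "emeasure (distr lborel borel from_copy) (box l u) = (\<Prod>b\<in>Basis. (u - l) \<bullet> b)" .
qed simp

text \<open>Conjugating by the relabelling maps gives an orthogonal map on the well-ordered copy,
  and the relabelling itself preserves Lebesgue measure.\<close>

lemma lborel_orthogonal:
  fixes f :: "real^'n::finite \<Rightarrow> real^'n"
  assumes f: "orthogonal_transformation f"
  shows "distr lborel borel f = lborel"
proof -
  let ?g = "\<lambda>y. to_copy (f (from_copy y))"
  have lf: "linear f" using f by (rule orthogonal_transformation_linear)
  have "linear ?g"
    using linear_compose[OF linear_compose[OF linear_from_copy lf] linear_to_copy] by (simp add: o_def)
  moreover have "?g x \<bullet> ?g y = x \<bullet> y" for x y
    using f by (simp add: inner_to_copy inner_from_copy orthogonal_transformation_def)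
  ultimately have "orthogonal_transformation ?g"
    by (simp add: orthogonal_transformation_def)
  hence g: "distr lborel borel ?g = lborel"
    by (rule lborel_orthogonal_wellorder)
  note [measurable] = measurable_linear[OF lf] measurable_linear[OF linear_from_copy]
    measurable_linear[OF linear_to_copy] measurable_linear[OF \<open>linear ?g\<close>]
  have "distr lborel borel f = distr (distr lborel borel from_copy) borel f"
    by (simp only: lborel_from_copy)
  also have "\<dots> = distr (distr lborel borel ?g) borel from_copy"
    by (simp add: distr_distr o_def)
  also have "\<dots> = lborel"
    by (simp only: g lborel_from_copy)
  finally show ?thesis .
qed

section \<open>The uniform distribution on the sphere\<close>

lemma measurable_normalize [measurable]: "(\<lambda>x::'a::euclidean_space. x /\<^sub>R norm x) \<in> borel_measurable borel"
  by measurable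

text \<open>The integrand is extended to be constant along rays, which reduces every statement about
  the surface measure to the punctured unit ball.\<close>

lemma nn_integral_sphere_measure:
  fixes h :: "real^'n::finite \<Rightarrow> ennreal"
  assumes [measurable]: "h \<in> borel_measurable borel"
  shows "(\<integral>\<^sup>+x. h x \<partial>sphere_measure) =
    ennreal (real CARD('n)) * (\<integral>\<^sup>+x. indicator (cball 0 1 - {0}) x * h (x /\<^sub>R norm x) \<partial>lborel)"
proof -
  have [measurable]: "cball 0 1 - {0 :: real^'n} \<in> sets borel" by simp
  have "(\<integral>\<^sup>+x. h x \<partial>sphere_measure) = ennreal (real CARD('n)) *
      (\<integral>\<^sup>+x. h (x /\<^sub>R norm x) \<partial>(density lborel (indicator (cball 0 1 - {0}))))"
    unfolding sphere_measure_def by (simp add: nn_integral_density nn_integral_distr nn_integral_cmult)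
  also have "(\<integral>\<^sup>+x. h (x /\<^sub>R norm x) \<partial>(density lborel (indicator (cball 0 1 - {0})))) =
      (\<integral>\<^sup>+x. indicator (cball 0 1 - {0}) x * h (x /\<^sub>R norm x) \<partial>lborel)"
    by (rule nn_integral_density) measurable
  finally show ?thesis .
qed

lemma sets_sphere_measure [measurable_cong, simp]: "sets sphere_measure = sets borel"
  by (simp add: sphere_measure_def)

lemma space_sphere_measure [simp]: "space sphere_measure = UNIV"
  by (simp add: sphere_measure_def)

lemma sets_unif_sphere [measurable_cong, simp]: "sets unif_sphere = sets borel"
  by (simp add: unif_sphere_def)

lemma space_unif_sphere [simp]: "space unif_sphere = UNIV"
  by (simp add: unif_sphere_def)

lemma omega_pos: "omega d > 0"
  unfolding omega_def by (intro divide_pos_pos mult_pos_pos Gamma_real_pos) auto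

lemma nn_integral_unif_sphere:
  fixes h :: "real^'n::finite \<Rightarrow> ennreal"
  assumes [measurable]: "h \<in> borel_measurable borel"
  shows "(\<integral>\<^sup>+x. h x \<partial>unif_sphere) = ennreal (1 / omega (CARD('n) - 1)) * (\<integral>\<^sup>+x. h x \<partial>sphere_measure)"
  unfolding unif_sphere_def by (simp add: nn_integral_density nn_integral_cmult)

text \<open>The measure is defined on all Borel sets of the ambient space, so facts valid only on
  the sphere enter as almost-everywhere statements. Removing the origin from the ball ensures that
  normalized points have length one.\<close>

lemma AE_unif_sphere: "AE x in (unif_sphere :: (real^'n::finite) measure). norm x = 1"
proof -
  have "(\<integral>\<^sup>+x. indicator {x :: real^'n. norm x \<noteq> 1} x \<partial>unif_sphere) = 0"
  proof -
    have "AE x :: real^'n in lborel. norm x \<le> 1 \<longrightarrow> x = 0 \<or> inverse (norm x) * norm x = 1"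
    proof (intro AE_I2 impI)
      fix x :: "real^'n"
      show "x = 0 \<or> inverse (norm x) * norm x = 1" by (cases "x = 0") simp_all
    qed
    thus ?thesis
      by (simp add: nn_integral_unif_sphere nn_integral_sphere_measure nn_integral_0_iff_AE indicator_def)
  qed
  thus ?thesis
    by (subst (asm) nn_integral_0_iff_AE) (auto simp: indicator_def)
qed

text \<open>The cone measure has mass n times the volume of the unit ball of dimension n, and
  Gamma(n/2 + 1) = (n/2) Gamma(n/2) identifies this with \<open>omega (n - 1)\<close>.\<close>

lemma prob_space_unif_sphere: "prob_space (unif_sphere :: (real^'n::finite) measure)"
proof
  let ?n = "CARD('n)"
  have n: "?n > 0" by simp
  have "emeasure (unif_sphere :: (real^'n) measure) (space unif_sphere) = (\<integral>\<^sup>+x. 1 \<partial>(unif_sphere :: (real^'n) measure))"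
    by simp
  also have "\<dots> = ennreal (1 / omega (?n - 1)) * (ennreal (real ?n) *
      (\<integral>\<^sup>+x. indicator (cball 0 1 - {0}) x \<partial>(lborel :: (real^'n) measure)))"
    by (subst nn_integral_unif_sphere, simp, subst nn_integral_sphere_measure, simp_all)
  also have "(\<integral>\<^sup>+x. indicator (cball 0 1 - {0}) x \<partial>(lborel :: (real^'n) measure)) = emeasure lborel (cball 0 1 - {0} :: (real^'n) set)"
    by (rule nn_integral_indicator) simp
  also have "\<dots> = emeasure lborel (cball 0 1 :: (real^'n) set)"
    by (subst emeasure_Diff) auto
  also have "\<dots> = ennreal (unit_ball_vol (real ?n))"
    by (subst emeasure_cball) auto
  also have "ennreal (1 / omega (?n - 1)) * (ennreal (real ?n) * ennreal (unit_ball_vol (real ?n))) =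
     ennreal (1 / omega (?n - 1) * (real ?n * unit_ball_vol (real ?n)))"
    using omega_pos[of "?n - 1"] by (simp add: ennreal_mult[symmetric])
  also have "1 / omega (?n - 1) * (real ?n * unit_ball_vol (real ?n)) = 1"
  proof -
    have "real (?n - 1) + 1 = real ?n" using n by simp
    moreover have "Gamma (real ?n / 2 + 1) = real ?n / 2 * Gamma (real ?n / 2)"
      using n by (intro Gamma_plus1 pos_notin_nonpos_Ints) simp
    moreover have "Gamma (real ?n / 2) \<noteq> 0"
      by (rule less_imp_neq[symmetric], rule Gamma_real_pos) (use n in simp)
    ultimately show ?thesis using n
      by (simp add: omega_def unit_ball_vol_def mult.commute)
  qed
  finally show "emeasure (unif_sphere :: (real^'n) measure) (space unif_sphere) = 1" by simp
qed

text \<open>An orthogonal map commutes with normalization and preserves the punctured ball, so the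
  claim reduces to Lebesgue measure.\<close>

lemma distr_unif_sphere_orthogonal:
  fixes f :: "real^'n::finite \<Rightarrow> real^'n"
  assumes f: "orthogonal_transformation f"
  shows "distr unif_sphere borel f = unif_sphere"
proof (rule measure_eqI)
  have [measurable]: "f \<in> borel_measurable borel"
    using f by (intro measurable_linear orthogonal_transformation_linear)
  fix A assume "A \<in> sets (distr unif_sphere borel f)"
  hence A [measurable]: "A \<in> sets borel" by simp
  have [measurable]: "cball 0 1 - {0 :: real^'n} \<in> sets borel" by simp
  let ?h = "indicator A :: real^'n \<Rightarrow> ennreal"
  have "emeasure (distr unif_sphere borel f) A = (\<integral>\<^sup>+x. ?h x \<partial>(distr unif_sphere borel f))"
    by simp
  also have "\<dots> = (\<integral>\<^sup>+x. ?h (f x) \<partial>unif_sphere)"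
    by (rule nn_integral_distr) simp_all
  also have "\<dots> = ennreal (1 / omega (CARD('n) - 1)) * (ennreal (real CARD('n)) *
     (\<integral>\<^sup>+x. indicator (cball 0 1 - {0}) x * ?h (f (x /\<^sub>R norm x)) \<partial>lborel))"
    by (simp add: nn_integral_unif_sphere nn_integral_sphere_measure)
  also have "(\<integral>\<^sup>+x. indicator (cball 0 1 - {0}) x * ?h (f (x /\<^sub>R norm x)) \<partial>lborel) =
     (\<integral>\<^sup>+x. indicator (cball 0 1 - {0}) (f x) * ?h (f x /\<^sub>R norm (f x)) \<partial>lborel)"
  proof (intro nn_integral_cong arg_cong2[where f = "(*)"])
    fix x
    have nf: "norm (f x) = norm x" using f by (rule orthogonal_transformation_norm)
    show "?h (f (x /\<^sub>R norm x)) = ?h (f x /\<^sub>R norm (f x))"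
      unfolding nf using orthogonal_transformation_linear[OF f] by (simp add: linear_scale)
    have "f x = 0 \<longleftrightarrow> x = 0" using nf norm_eq_zero by metis
    thus "indicator (cball 0 1 - {0}) x = (indicator (cball 0 1 - {0}) (f x) :: ennreal)"
      by (simp add: indicator_def nf)
  qed
  also have "\<dots> = (\<integral>\<^sup>+x. indicator (cball 0 1 - {0}) x * ?h (x /\<^sub>R norm x) \<partial>(distr lborel borel f))"
    by (subst nn_integral_distr) auto
  also have "distr lborel borel f = lborel" by (rule lborel_orthogonal[OF f])
  also have "ennreal (1 / omega (CARD('n) - 1)) * (ennreal (real CARD('n)) *
      (\<integral>\<^sup>+x. indicator (cball 0 1 - {0}) x * ?h (x /\<^sub>R norm x) \<partial>lborel)) = (\<integral>\<^sup>+x. ?h x \<partial>unif_sphere)"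
    by (subst nn_integral_unif_sphere, simp, subst nn_integral_sphere_measure, simp, rule refl)
  also have "\<dots> = emeasure unif_sphere A" by simp
  finally show "emeasure (distr unif_sphere borel f) A = emeasure unif_sphere A" .
qed simp

lemma integrable_unif_sphere:
  fixes h :: "real^'n::finite \<Rightarrow> real"
  assumes "continuous_on UNIV h"
  shows "integrable unif_sphere h"
proof -
  interpret prob_space "unif_sphere :: (real^'n) measure" by (rule prob_space_unif_sphere)
  have "compact (h ` sphere 0 1)"
    using assms by (intro compact_continuous_image) (auto intro: continuous_on_subset)
  then obtain B where "\<forall>y \<in> h ` sphere 0 1. norm y \<le> B"
    using compact_imp_bounded bounded_iff by metis
  hence B: "norm (h x) \<le> B" if "norm x = 1" for x
    using that by simp
  show ?thesis
  proof (rule integrable_const_bound)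
    show "AE x in unif_sphere. norm (h x) \<le> B"
      using AE_unif_sphere by eventually_elim (rule B)
    show "h \<in> borel_measurable unif_sphere"
      using borel_measurable_continuous_onI[OF assms] by simp
  qed
qed

lemma integral_unif_sphere_orthogonal:
  fixes f :: "real^'n::finite \<Rightarrow> real^'n" and h :: "real^'n::finite \<Rightarrow> real"
  assumes f: "orthogonal_transformation f" and h: "h \<in> borel_measurable borel"
  shows "(\<integral>x. h (f x) \<partial>unif_sphere) = (\<integral>x. h x \<partial>unif_sphere)"
proof -
  have [measurable]: "f \<in> borel_measurable borel"
    using f by (intro measurable_linear orthogonal_transformation_linear)
  have "(\<integral>x. h (f x) \<partial>unif_sphere) = (\<integral>x. h x \<partial>(distr unif_sphere borel f))"
    using h by (subst integral_distr) auto
  thus ?thesis by (simp add: distr_unif_sphere_orthogonal[OF f])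
qed

text \<open>Some orthogonal f carries a to b, and then
  \<open>b \<bullet> f x = a \<bullet> x\<close>.\<close>

lemma unif_sphere_moment_norm:
  fixes a b :: "real^'n::finite"
  assumes "norm a = norm b"
  shows "(\<integral>x. (a \<bullet> x) ^ m \<partial>unif_sphere) = (\<integral>x. (b \<bullet> x) ^ m \<partial>unif_sphere)"
proof -
  obtain f where f: "orthogonal_transformation f" "f a = b"
    using orthogonal_transformation_exists[OF assms] by blast
  have "(\<integral>x. (b \<bullet> x) ^ m \<partial>unif_sphere) = (\<integral>x. (b \<bullet> f x) ^ m \<partial>unif_sphere)"
    by (rule integral_unif_sphere_orthogonal[OF f(1), symmetric]) simp
  also have "\<dots> = (\<integral>x. (a \<bullet> x) ^ m \<partial>unif_sphere)"
    using f by (auto simp: orthogonal_transformation_def)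
  finally show ?thesis ..
qed

lemma unif_sphere_moment_odd:
  fixes a :: "real^'n::finite"
  assumes "odd m"
  shows "(\<integral>x. (a \<bullet> x) ^ m \<partial>unif_sphere) = 0"
  using unif_sphere_moment_norm[of a "- a" m] assms by simp

section \<open>Mixed moments of two linear forms\<close>

lemma integrable_unif_sphere_powers:
  "integrable unif_sphere (\<lambda>x :: real^'n::finite. (v \<bullet> x) ^ m * (\<mu> \<bullet> x) ^ p)"
  by (intro integrable_unif_sphere continuous_intros)

text \<open>Here \<open>\<kappa>\<close> is a hypothesis, so the formula is available before the
  constant is known. The guard \<open>m \<le> n + j\<close> and the range j \<le> m div 2 are the
  two conditions n-j \<le> p and p \<le> 2(n-j) under which t^p occurs in (2t(v.mu) +
  t^2)^(n-j).\<close>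

lemma unif_sphere_moment_wick:
  fixes \<mu> v :: "real^'n::finite"
  assumes \<kappa>: "\<And>w :: real^'n. (\<integral>x. (w \<bullet> x) ^ (2 * n) \<partial>unif_sphere) = \<kappa> * (norm w ^ 2) ^ n"
    and mp: "m + p = 2 * n" and \<mu>: "norm \<mu> = 1"
  shows "(\<integral>x. (v \<bullet> x) ^ m * (\<mu> \<bullet> x) ^ p \<partial>unif_sphere) =
    \<kappa> * (fact m * fact p * fact n / fact (2 * n)) * (\<Sum>j\<le>m div 2. if m \<le> n + j then
       (2 * (v \<bullet> \<mu>)) ^ (m - 2 * j) * (v \<bullet> v) ^ j / (fact j * fact (n + j - m) * fact (m - 2 * j)) else 0)"
proof -
  define E where "E q = (\<integral>x. (v \<bullet> x) ^ (2 * n - q) * (\<mu> \<bullet> x) ^ q \<partial>unif_sphere)" for q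
  define L where "L = (\<Sum>q\<le>2 * n. monom (real (2 * n choose q) * E q) q)"
  define R where "R = smult \<kappa> (\<Sum>j\<le>n. smult (real (n choose j) * (v \<bullet> v) ^ j) ([:0, 2 * (v \<bullet> \<mu>), 1:] ^ (n - j)))"
  have "poly L t = poly R t" for t
  proof -
    have "poly L t = (\<Sum>q\<le>2 * n. \<integral>x. real (2 * n choose q) * (t * (\<mu> \<bullet> x)) ^ q * (v \<bullet> x) ^ (2 * n - q) \<partial>unif_sphere)"
      unfolding L_def poly_sum poly_monom E_def
      by (intro sum.cong refl) (simp add: power_mult_distrib mult_ac flip: integral_mult_right_zero)
    also have "\<dots> = (\<integral>x. (\<Sum>q\<le>2 * n. real (2 * n choose q) * (t * (\<mu> \<bullet> x)) ^ q * (v \<bullet> x) ^ (2 * n - q)) \<partial>unif_sphere)"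
      by (intro Bochner_Integration.integral_sum[symmetric] integrable_unif_sphere continuous_intros)
    also have "\<dots> = (\<integral>x. ((t *\<^sub>R \<mu> + v) \<bullet> x) ^ (2 * n) \<partial>unif_sphere)"
      by (simp add: binomial_ring inner_add_left)
    also have "\<dots> = \<kappa> * (norm (t *\<^sub>R \<mu> + v) ^ 2) ^ n"
      by (rule \<kappa>)
    also have "norm (t *\<^sub>R \<mu> + v) ^ 2 = v \<bullet> v + t * (2 * (v \<bullet> \<mu>) + t)"
    proof -
      have "\<mu> \<bullet> \<mu> = 1" using \<mu> by (simp add: dot_square_norm)
      thus ?thesis
        by (simp add: power2_norm_eq_inner inner_add_left inner_add_right inner_commute algebra_simps)
    qed
    also have "(v \<bullet> v + t * (2 * (v \<bullet> \<mu>) + t)) ^ n = (\<Sum>j\<le>n. real (n choose j) * (v \<bullet> v) ^ j * (t * (2 * (v \<bullet> \<mu>) + t)) ^ (n - j))"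
      by (rule binomial_ring)
    also have "\<kappa> * \<dots> = poly R t"
      by (simp add: R_def poly_sum)
    finally show ?thesis .
  qed
  hence "L = R" by (simp add: poly_eq_poly_eq_iff[symmetric] fun_eq_iff)
  moreover have "coeff L p = real (2 * n choose p) * E p"
    using mp by (simp add: L_def coeff_sum)
  moreover have "coeff R p = \<kappa> * (fact n * (\<Sum>j\<le>m div 2. if m \<le> n + j then
       (2 * (v \<bullet> \<mu>)) ^ (m - 2 * j) * (v \<bullet> v) ^ j / (fact j * fact (n + j - m) * fact (m - 2 * j)) else 0))"
  proof -
    have "(\<Sum>j\<le>n. real (n choose j) * (v \<bullet> v) ^ j * coeff ([:0, 2 * (v \<bullet> \<mu>), 1:] ^ (n - j)) p) =
       (\<Sum>j\<le>m div 2. fact n * (if m \<le> n + j then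
       (2 * (v \<bullet> \<mu>)) ^ (m - 2 * j) * (v \<bullet> v) ^ j / (fact j * fact (n + j - m) * fact (m - 2 * j)) else 0))"
    proof (rule sum.mono_neutral_cong_right)
      show "{..m div 2} \<subseteq> {..n}" using mp by auto
      show "\<forall>j\<in>{..n} - {..m div 2}. real (n choose j) * (v \<bullet> v) ^ j * coeff ([:0, 2 * (v \<bullet> \<mu>), 1:] ^ (n - j)) p = 0"
        using mp by (auto simp: coeff_X_mult_linear_power)
      fix j assume "j \<in> {..m div 2}"
      hence j: "2 * j \<le> m" "j \<le> n" using mp by auto
      show "real (n choose j) * (v \<bullet> v) ^ j * coeff ([:0, 2 * (v \<bullet> \<mu>), 1:] ^ (n - j)) p =
         fact n * (if m \<le> n + j then
       (2 * (v \<bullet> \<mu>)) ^ (m - 2 * j) * (v \<bullet> v) ^ j / (fact j * fact (n + j - m) * fact (m - 2 * j)) else 0)"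
      proof (cases "m \<le> n + j")
        case True
        have e: "p - (n - j) = n + j - m" "2 * (n - j) - p = m - 2 * j" "n - j - (n + j - m) = m - 2 * j"
           "n - j \<le> p" "p \<le> 2 * (n - j)" "n + j - m \<le> n - j"
          using j mp True by auto
        have "real (n choose j) * real ((n - j) choose (n + j - m)) = fact n / (fact j * fact (n + j - m) * fact (m - 2 * j))"
          unfolding binomial_fact[OF j(2), where 'a = real] binomial_fact[OF e(6), where 'a = real] e(3) by simp
        thus ?thesis using e True by (simp add: coeff_X_mult_linear_power field_simps)
      next
        case False
        hence "\<not> n - j \<le> p" using j mp by auto
        thus ?thesis using False by (simp add: coeff_X_mult_linear_power)
      qed
    qed auto
    thus ?thesis by (simp add: R_def coeff_sum sum_distrib_left)
  qed
  moreover have "real (2 * n choose p) = fact (2 * n) / (fact p * fact m)"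
  proof -
    have "2 * n - p = m" "p \<le> 2 * n" using mp by auto
    thus ?thesis by (simp add: binomial_fact)
  qed
  moreover have "E p = (\<integral>x. (v \<bullet> x) ^ m * (\<mu> \<bullet> x) ^ p \<partial>unif_sphere)"
  proof -
    have "2 * n - p = m" using mp by auto
    thus ?thesis by (simp add: E_def)
  qed
  ultimately have "fact (2 * n) / (fact p * fact m) * (\<integral>x. (v \<bullet> x) ^ m * (\<mu> \<bullet> x) ^ p \<partial>unif_sphere) =
      \<kappa> * (fact n * (\<Sum>j\<le>m div 2. if m \<le> n + j then
       (2 * (v \<bullet> \<mu>)) ^ (m - 2 * j) * (v \<bullet> v) ^ j / (fact j * fact (n + j - m) * fact (m - 2 * j)) else 0))"
    (is "?b * ?I = \<kappa> * (fact n * ?S)")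
    by simp
  moreover have "?I = (?b * ?I) * (fact p * fact m / fact (2 * n))"
    by simp
  ultimately show ?thesis by (simp only: mult_ac times_divide_eq_right times_divide_eq_left)
qed

text \<open>The moment of order 2n of one coordinate on the unit sphere of the D-dimensional space;
  D is the ambient dimension, hence d + 1 in the theorem.\<close>

definition kappa :: "nat \<Rightarrow> nat \<Rightarrow> real" where
  "kappa D n = oddfact n / (\<Prod>r<n. real D + 2 * real r)"

lemma unif_sphere_moment_even:
  fixes w :: "real^'n::finite"
  shows "(\<integral>x. (w \<bullet> x) ^ (2 * n) \<partial>unif_sphere) = kappa CARD('n) n * (norm w ^ 2) ^ n"
proof (induction n arbitrary: w)
  case 0
  interpret prob_space "unif_sphere :: (real^'n) measure" by (rule prob_space_unif_sphere)
  show ?case using prob_space by (simp add: kappa_def oddfact_def)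
next
  case (Suc n)
  obtain i0 :: 'n where True by simp
  let ?e = "axis i0 1 :: real^'n"
  define \<kappa> where "\<kappa> = (\<integral>x. (?e \<bullet> x) ^ (2 * Suc n) \<partial>unif_sphere)"
  have \<kappa>: "(\<integral>x. (w \<bullet> x) ^ (2 * Suc n) \<partial>unif_sphere) = \<kappa> * (norm w ^ 2) ^ Suc n" for w :: "real^'n"
  proof -
    have "(\<integral>x. (w \<bullet> x) ^ (2 * Suc n) \<partial>unif_sphere) = (\<integral>x. ((norm w *\<^sub>R ?e) \<bullet> x) ^ (2 * Suc n) \<partial>unif_sphere)"
      by (rule unif_sphere_moment_norm) (simp add: norm_axis_1)
    also have "\<dots> = (\<integral>x. norm w ^ (2 * Suc n) * (?e \<bullet> x) ^ (2 * Suc n) \<partial>unif_sphere)"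
      by (simp only: inner_scaleR_left power_mult_distrib)
    also have "\<dots> = norm w ^ (2 * Suc n) * \<kappa>"
      unfolding \<kappa>_def by (rule integral_mult_right_zero)
    also have "norm w ^ (2 * Suc n) = (norm w ^ 2) ^ Suc n"
      by (rule power_mult)
    finally show ?thesis by (simp only: mult.commute)
  qed
  \<comment> \<open>For two different axes every term with a positive power of the inner product
    vanishes, so only j = 1 remains and the factorials leave 1/(2n+1).\<close>
  have off: "(\<integral>x. (axis i 1 \<bullet> x) ^ 2 * (?e \<bullet> x) ^ (2 * n) \<partial>unif_sphere) = \<kappa> / (2 * real n + 1)" if "i \<noteq> i0" for i
  proof -
    have "2 + 2 * n = 2 * Suc n" "norm ?e = 1" by (simp_all add: norm_axis_1)
    note * = unif_sphere_moment_wick[OF \<kappa> this, of "axis i 1"]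
    have ip: "axis i 1 \<bullet> ?e = 0" "axis i (1::real) \<bullet> axis i 1 = 1"
      using that by (simp_all add: inner_axis_axis)
    have set: "{..(2::nat) div 2} = {0, 1}" by auto
    have f: "fact (2 * Suc n) = (2 * real n + 2) * ((2 * real n + 1) * fact (2 * n))"
      by (simp add: algebra_simps)
    show ?thesis unfolding * ip set f
      by (simp add: divide_simps)
  qed
  have "kappa CARD('n) n = (\<integral>x. (?e \<bullet> x) ^ (2 * n) \<partial>unif_sphere)"
    using Suc[of ?e] by (simp add: norm_axis_1)
  \<comment> \<open>Inserting 1 = |x|^2 gives one diagonal term \<open>\<kappa>\<close> and D - 1
    terms \<open>\<kappa>\<close>/(2n+1), hence kappa(n) = \<open>\<kappa>\<close>
    (D+2n)/(2n+1).\<close>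
  also have "\<dots> = (\<integral>x. (\<Sum>i\<in>UNIV. (axis i 1 \<bullet> x) ^ 2 * (?e \<bullet> x) ^ (2 * n)) \<partial>unif_sphere)"
  proof (rule integral_cong_AE)
    show "AE x in unif_sphere. (?e \<bullet> x) ^ (2 * n) = (\<Sum>i\<in>UNIV. (axis i 1 \<bullet> x) ^ 2 * (?e \<bullet> x) ^ (2 * n))"
      using AE_unif_sphere
    proof eventually_elim
      case (elim x)
      have "(\<Sum>i\<in>UNIV. (axis i 1 \<bullet> x) ^ 2) = x \<bullet> x"
        by (simp add: inner_vec_def[of x x] inner_axis' power2_eq_square)
      also have "\<dots> = 1" using elim by (simp add: dot_square_norm)
      finally show ?case by (simp add: sum_distrib_right[symmetric])
    qed
  qed auto
  also have "\<dots> = (\<Sum>i\<in>UNIV. \<integral>x. (axis i 1 \<bullet> x) ^ 2 * (?e \<bullet> x) ^ (2 * n) \<partial>unif_sphere)"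
    by (intro Bochner_Integration.integral_sum integrable_unif_sphere_powers)
  also have "\<dots> = (\<integral>x. (?e \<bullet> x) ^ 2 * (?e \<bullet> x) ^ (2 * n) \<partial>unif_sphere) + (\<Sum>i\<in>UNIV - {i0}. \<kappa> / (2 * real n + 1))"
    by (subst sum.remove[of UNIV i0]) (auto simp: off)
  also have "(\<integral>x. (?e \<bullet> x) ^ 2 * (?e \<bullet> x) ^ (2 * n) \<partial>unif_sphere) = \<kappa>"
    by (simp add: \<kappa>_def power2_eq_square mult_ac)
  also have "(\<Sum>i\<in>UNIV - {i0}. \<kappa> / (2 * real n + 1)) = (real CARD('n) - 1) * \<kappa> / (2 * real n + 1)"
    by (simp add: card_Diff_singleton of_nat_diff)
  finally have "kappa CARD('n) n = \<kappa> * (real CARD('n) + 2 * real n) / (2 * real n + 1)"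
    by (simp add: field_simps)
  hence "\<kappa> = kappa CARD('n) n * (2 * real n + 1) / (real CARD('n) + 2 * real n)"
    by (simp add: field_simps add_nonneg_eq_0_iff)
  also have "\<dots> = kappa CARD('n) (Suc n)"
    by (simp add: kappa_def oddfact_def)
  finally show ?case using \<kappa>[of w] by simp
qed

lemma unif_sphere_moment:
  fixes w :: "real^'n::finite"
  shows "(\<integral>x. (w \<bullet> x) ^ m \<partial>unif_sphere) = (if even m then kappa CARD('n) (m div 2) * (w \<bullet> w) ^ (m div 2) else 0)"
  using unif_sphere_moment_even[of w "m div 2"] unif_sphere_moment_odd[of m w]
  by (cases "even m") (simp_all add: power2_norm_eq_inner)

lemmas unif_sphere_mixed_moment = unif_sphere_moment_wick[OF unif_sphere_moment_even]

section \<open>Beta integrals\<close>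

text \<open>Substitution t = sqrt u. The open interval matters: for y < 1 the integrand is unbounded
  near 1.\<close>

lemma has_bochner_integral_half_beta:
  fixes q :: nat and y :: real
  assumes y: "y > 0"
  shows "has_bochner_integral lborel (\<lambda>t. indicator {0<..<1} t * (t ^ (2 * q) * (1 - t ^ 2) powr (y - 1)))
    (Beta (real q + 1 / 2) y / 2)"
proof -
  define h where "h = (\<lambda>t::real. t ^ (2 * q) * (1 - t ^ 2) powr (y - 1))"
  let ?b = "\<lambda>u::real. u powr (real q + 1 / 2 - 1) * (1 - u) powr (y - 1)"
  \<comment> \<open>The Jacobian contributes u^(-1/2)/2, which shifts the first Beta parameter from
    q + 1 to q + 1/2 and produces the factor 1/2.\<close>
  have eq: "h (sqrt u) * (1 / (2 * sqrt u)) = ?b u / 2" if "0 < u" "u < 1" for u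
  proof -
    have "sqrt u ^ (2 * q) = u powr real q"
      using that by (simp add: power_mult powr_realpow)
    moreover have "1 / sqrt u = u powr (- (1 / 2))"
      using that by (simp add: powr_minus powr_half_sqrt field_simps)
    ultimately have "sqrt u ^ (2 * q) * (1 / sqrt u) = u powr (real q + 1 / 2 - 1)"
      by (simp add: powr_add[symmetric])
    thus ?thesis using that by (simp add: h_def field_simps)
  qed
  have bint: "set_integrable lborel {0..1} ?b"
    using y by (intro integrable_Beta) auto
  have bint': "set_integrable lborel {0<..<1} ?b"
    by (rule set_integrable_subset[OF bint]) auto
  have bval: "(LINT u:{0<..<1}|lborel. ?b u) = Beta (real q + 1 / 2) y"
  proof -
    have "((\<lambda>u. ?b u) has_integral Beta (real q + 1 / 2) y) {0<..<1}"
      using has_integral_Beta_real[of "real q + 1 / 2" y] y by (simp add: has_integral_Icc_iff_Ioo)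
    thus ?thesis
      using set_borel_integral_eq_integral(2)[OF bint'] by (simp add: integral_unique)
  qed
  have int: "set_integrable lborel (einterval 0 1) (\<lambda>u. h (sqrt u) * (1 / (2 * sqrt u)))"
  proof -
    have "set_integrable lborel {0<..<1} (\<lambda>u. ?b u / 2)"
      using bint' by (rule set_integrable_divide) 
    also have "?this \<longleftrightarrow> set_integrable lborel {0<..<1} (\<lambda>u. h (sqrt u) * (1 / (2 * sqrt u)))"
      by (intro set_integrable_cong refl) (subst eq, auto)
    finally show ?thesis by (simp add: einterval_def) (simp add: greaterThanLessThan_def greaterThan_def lessThan_def Int_def)
  qed
  have sub: "set_integrable lborel (einterval 0 1) h"
    "(LBINT x=0..1. h x) = (LBINT x=0..1. h (sqrt x) * (1 / (2 * sqrt x)))"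
  proof -
    have lim: "(sqrt \<longlongrightarrow> sqrt a) (at a within S)" for a S
      by (intro tendsto_real_sqrt tendsto_ident_at)
    have A: "((ereal \<circ> sqrt \<circ> real_of_ereal) \<longlongrightarrow> 0) (at_right 0)"
      unfolding zero_ereal_def using lim[of 0]
      by (intro ereal_tendsto_simps1[THEN iffD2]) (simp add: o_def)
    have B: "((ereal \<circ> sqrt \<circ> real_of_ereal) \<longlongrightarrow> 1) (at_left 1)"
      unfolding one_ereal_def using lim[of 1]
      by (intro ereal_tendsto_simps1[THEN iffD2]) (simp add: o_def)
    have d: "DERIV sqrt x :> 1 / (2 * sqrt x)" if "(0::ereal) < ereal x" for x
      using that by (auto intro!: derivative_eq_intros simp: field_simps)
    have c: "isCont h (sqrt x)" if "(0::ereal) < ereal x" "ereal x < 1" for x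
      using that unfolding h_def by (intro continuous_intros) (auto simp: one_ereal_def)
    have c': "isCont (\<lambda>x. 1 / (2 * sqrt x)) x" if "(0::ereal) < ereal x" for x
      using that by (intro continuous_intros) auto
    have n: "0 \<le> h t" for t by (simp add: h_def)
    have n': "0 \<le> 1 / (2 * sqrt x)" if "(0::ereal) \<le> ereal x" for x
      using that by (simp add: zero_ereal_def)
    show "set_integrable lborel (einterval 0 1) h"
      "(LBINT x=0..1. h x) = (LBINT x=0..1. h (sqrt x) * (1 / (2 * sqrt x)))"
      using interval_integral_substitution_nonneg[of 0 1 sqrt "\<lambda>x. 1 / (2 * sqrt x)" h, OF _ d c c' n n' A B int]
      by simp_all
  qed
  have ei: "einterval 0 1 = {0<..<1::real}"
    by (auto simp: einterval_def zero_ereal_def one_ereal_def)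
  have "(LINT x:{0<..<1}|lborel. h x) = (LINT u:{0<..<1}|lborel. h (sqrt u) * (1 / (2 * sqrt u)))"
    using sub(2) by (simp add: interval_lebesgue_integral_def ei)
  also have "\<dots> = (LINT u:{0<..<1}|lborel. ?b u / 2)"
    by (intro set_lebesgue_integral_cong allI impI) (simp, subst eq, auto)
  also have "\<dots> = Beta (real q + 1 / 2) y / 2"
    using bval by simp
  finally show ?thesis
    using sub(1) unfolding ei has_bochner_integral_iff set_integrable_def set_lebesgue_integral_def h_def by simp
qed

text \<open>The integrand is even; the reflected half is glued on up to the null set containing only
  0.\<close>

lemma has_bochner_integral_sym_beta:
  fixes q :: nat and y :: real
  assumes y: "y > 0"
  shows "has_bochner_integral lborel (\<lambda>t. indicator {-1<..<1} t * (t ^ (2 * q) * (1 - t ^ 2) powr (y - 1)))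
    (Beta (real q + 1 / 2) y)"
proof -
  let ?h = "\<lambda>t::real. t ^ (2 * q) * (1 - t ^ 2) powr (y - 1)"
  note H = has_bochner_integral_half_beta[OF y, of q]
  have "has_bochner_integral lborel (\<lambda>t. indicator {0<..<1} (0 + (-1) * t) * ?h (0 + (-1) * t)) (Beta (real q + 1 / 2) y / 2)"
    using H by (subst (asm) lborel_has_bochner_integral_real_affine_iff[of "-1" _ _ 0]) simp_all
  hence "has_bochner_integral lborel (\<lambda>t. indicator {0<..<1} t * ?h t + indicator {0<..<1} (- t) * ?h t)
      (Beta (real q + 1 / 2) y / 2 + Beta (real q + 1 / 2) y / 2)"
    using H by (intro has_bochner_integral_add) simp_all
  moreover have "AE t in lborel. indicator {0<..<1} t * ?h t + indicator {0<..<1} (- t) * ?h t = indicator {-1<..<1} t * ?h t"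
    using AE_lborel_singleton[of "0::real"] by eventually_elim (auto simp: indicator_def)
  ultimately show ?thesis
    by (subst (asm) has_bochner_integral_cong_AE[of _ _ "\<lambda>t. indicator {-1<..<1} t * ?h t"]) auto
qed

text \<open>When m + k is even, each monomial meets t^(m-2j) in an even power, so the integral
  splits into symmetric Beta integrals. The integration domain is the open interval, where the
  coefficient formula applies.\<close>

lemma f_int_sum:
  assumes "d \<ge> 1" "k \<ge> 1" "even (m + k)" "j \<le> m div 2"
  shows "f_int d k m j = (\<Sum>s\<le>k div 2. geg_coef d k s * Beta (real ((m + k) div 2 - s - j) + 1 / 2) (real d / 2 + real j))"
proof -
  have ei: "einterval (- 1) 1 = {-1<..<1::real}"
    by (auto simp: einterval_def one_ereal_def uminus_ereal.simps simp flip: ereal_minus(1))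
  have le: "(- 1 :: ereal) \<le> 1" by (simp add: one_ereal_def)
  have e: "2 * ((m + k) div 2 - s - j) = (m - 2 * j) + (k - 2 * s)" if "s \<le> k div 2" for s
  proof -
    obtain c where c: "m + k = 2 * c" using assms(3) by (elim evenE)
    have "(m + k) div 2 = c" using c by simp
    thus ?thesis using c that assms(4) by auto
  qed
  have "has_bochner_integral lborel (\<lambda>t. \<Sum>s\<le>k div 2. geg_coef d k s *
      (indicator {-1<..<1} t * (t ^ (2 * ((m + k) div 2 - s - j)) * (1 - t ^ 2) powr (real d / 2 + real j - 1))))
     (\<Sum>s\<le>k div 2. geg_coef d k s * Beta (real ((m + k) div 2 - s - j) + 1 / 2) (real d / 2 + real j))"
    using assms by (intro has_bochner_integral_sum has_bochner_integral_mult_right has_bochner_integral_sym_beta) auto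
  also have "(\<lambda>t. \<Sum>s\<le>k div 2. geg_coef d k s *
      (indicator {-1<..<1} t * (t ^ (2 * ((m + k) div 2 - s - j)) * (1 - t ^ 2) powr (real d / 2 + real j - 1)))) =
     (\<lambda>t. indicator {-1<..<1} t *\<^sub>R (t ^ (m - 2 * j) * (1 - t ^ 2) powr (real d / 2 - 1 + real j) * gegen d k t))"
  proof
    fix t :: real
    have pw: "real d / 2 + real j - 1 = real d / 2 - 1 + real j" by simp
    show "(\<Sum>s\<le>k div 2. geg_coef d k s *
      (indicator {-1<..<1} t * (t ^ (2 * ((m + k) div 2 - s - j)) * (1 - t ^ 2) powr (real d / 2 + real j - 1)))) =
      indicator {-1<..<1} t *\<^sub>R (t ^ (m - 2 * j) * (1 - t ^ 2) powr (real d / 2 - 1 + real j) * gegen d k t)"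
    proof (cases "t \<in> {-1<..<1}")
      case True
      hence A: "gegen d k t = (\<Sum>s\<le>k div 2. geg_coef d k s * t ^ (k - 2 * s))"
        using assms by (intro gegen_explicit) auto
      have B: "geg_coef d k s *
          (indicator {-1<..<1} t * (t ^ (2 * ((m + k) div 2 - s - j)) * (1 - t ^ 2) powr (real d / 2 + real j - 1))) =
          t ^ (m - 2 * j) * (1 - t ^ 2) powr (real d / 2 - 1 + real j) * (geg_coef d k s * t ^ (k - 2 * s))"
        if "s \<le> k div 2" for s
        unfolding e[OF that] power_add pw using True by simp
      have C: "indicator {-1<..<1} t *\<^sub>R x = x" for x :: real
        using True by simp
      show ?thesis
        unfolding A C sum_distrib_left by (intro sum.cong refl B) simp
    qed simp
  qed
  finally show ?thesis
    unfolding f_int_def interval_lebesgue_integral_def set_lebesgue_integral_def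
    using le by (simp add: has_bochner_integral_iff ei)
qed

text \<open>The two Beta parameters contain -j and +j, so j cancels in their sum and the denominator
  depends on s alone.\<close>

lemma f_int_eq_f_closed:
  assumes "d \<ge> 1" "k \<ge> 1" "even (m + k)" "j \<le> m div 2"
  shows "f_int d k m j = f_closed d k m j"
  unfolding f_int_sum[OF assms] f_closed_def sum_distrib_left
proof (intro sum.cong refl)
  fix s assume "s \<in> {..k div 2}"
  hence s: "j + s \<le> (m + k) div 2" "2 * ((m + k) div 2) = m + k" using assms by auto
  have q: "real ((m + k) div 2 - s - j) = (real m + real k) / 2 - real s - real j"
    using s by (simp add: of_nat_diff real_of_nat_div assms)
  have b1: "real ((m + k) div 2 - s - j) + 1 / 2 = (real m + real k + 1) / 2 - real j - real s"
    unfolding q by (simp add: field_simps)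
  have b2: "(real m + real k + 1) / 2 - real j - real s + (real d / 2 + real j) = (real d + real k + real m + 1) / 2 - real s"
    by (simp add: field_simps)
  show "geg_coef d k s * Beta (real ((m + k) div 2 - s - j) + 1 / 2) (real d / 2 + real j) =
     Gamma (real d / 2 + real j) * g_kd k d * ((-1) ^ s * 2 ^ (k - 2 * s) * Gamma ((real d - 1) / 2 + real k - real s)
        / (fact s * fact (k - 2 * s))
        * Gamma ((real m + real k + 1) / 2 - real j - real s)
        / Gamma ((real d + real k + real m + 1) / 2 - real s))"
    unfolding b1 Beta_def b2 geg_coef_def by (simp add: mult_ac)
qed

section \<open>Alternating sums of Gamma quotients\<close>

text \<open>Pascal's rule: a difference of order N + 1 is a difference of order N of first
  differences.\<close>

lemma alternating_binomial_Suc: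
  fixes f :: "nat \<Rightarrow> real"
  shows "(\<Sum>s\<le>Suc N. (-1) ^ s * real (Suc N choose s) * f s) =
    (\<Sum>s\<le>N. (-1) ^ s * real (N choose s) * (f s - f (Suc s)))"
proof -
  have step: "(-1) ^ Suc s * real (Suc N choose Suc s) * f (Suc s) =
      (-1) ^ Suc s * real (N choose Suc s) * f (Suc s) - (-1) ^ s * real (N choose s) * f (Suc s)" for s
    by (simp add: algebra_simps)
  have "(\<Sum>s\<le>Suc N. (-1) ^ s * real (Suc N choose s) * f s) =
     f 0 + (\<Sum>s\<le>N. (-1) ^ Suc s * real (N choose Suc s) * f (Suc s)) - (\<Sum>s\<le>N. (-1) ^ s * real (N choose s) * f (Suc s))"
    unfolding sum.atMost_Suc_shift step sum_subtractf by simp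
  also have "f 0 + (\<Sum>s\<le>N. (-1) ^ Suc s * real (N choose Suc s) * f (Suc s)) = (\<Sum>s\<le>Suc N. (-1) ^ s * real (N choose s) * f s)"
    by (subst sum.atMost_Suc_shift) simp
  also have "\<dots> = (\<Sum>s\<le>N. (-1) ^ s * real (N choose s) * f s)"
    by (simp add: binomial_eq_0)
  finally show ?thesis by (simp only: right_diff_distrib sum_subtractf)
qed

text \<open>The difference \<open>f s - f (s + 1)\<close> of the summand is \<open>q\<close> times the summand for
  \<open>y - 1\<close> and \<open>q - 1\<close>, which drives the induction.\<close>

lemma alternating_Gamma_sum:
  fixes y q :: real
  assumes "y > real N"
  shows "(\<Sum>s\<le>N. (-1) ^ s * real (N choose s) * (Gamma (y - real s) * rGamma (y - real s - q))) =
    (\<Prod>i<N. q - real i) * Gamma (y - real N) * rGamma (y - q)"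
  using assms
proof (induction N arbitrary: y q)
  case 0
  show ?case by simp
next
  case (Suc N)
  have "(\<Sum>s\<le>Suc N. (-1) ^ s * real (Suc N choose s) * (Gamma (y - real s) * rGamma (y - real s - q))) =
     (\<Sum>s\<le>N. (-1) ^ s * real (N choose s) * (q * (Gamma (y - 1 - real s) * rGamma (y - 1 - real s - (q - 1)))))"
    unfolding alternating_binomial_Suc
  proof (intro sum.cong refl arg_cong2[where f = "(*)"])
    fix s assume "s \<in> {..N}"
    hence "y - 1 - real s > 0" using Suc.prems by auto
    hence 1: "Gamma (y - real s) = (y - 1 - real s) * Gamma (y - 1 - real s)"
      by (subst Gamma_plus1[symmetric]) (simp_all add: pos_notin_nonpos_Ints)
    \<comment> \<open>The reciprocal Gamma function is entire, so its functional equation holds for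
      every real q.\<close>
    have 2: "rGamma (y - real (Suc s) - q) = (y - 1 - real s - q) * rGamma (y - real s - q)"
      using rGamma_plus1[of "y - real (Suc s) - q"] by (simp add: algebra_simps)
    have "y - real (Suc s) = y - 1 - real s" by simp
    hence 3: "Gamma (y - real (Suc s)) = Gamma (y - 1 - real s)" by (simp only:)
    have 4: "y - 1 - real s - (q - 1) = y - real s - q" by simp
    show "Gamma (y - real s) * rGamma (y - real s - q) - Gamma (y - real (Suc s)) * rGamma (y - real (Suc s) - q) =
       q * (Gamma (y - 1 - real s) * rGamma (y - 1 - real s - (q - 1)))"
      unfolding 1 2 3 4 by (simp add: algebra_simps)
  qed
  also have "\<dots> = q * (\<Sum>s\<le>N. (-1) ^ s * real (N choose s) * (Gamma (y - 1 - real s) * rGamma (y - 1 - real s - (q - 1))))"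
    by (simp add: sum_distrib_left mult_ac)
  also have "\<dots> = q * ((\<Prod>i<N. q - 1 - real i) * Gamma (y - 1 - real N) * rGamma (y - 1 - (q - 1)))"
    using Suc.prems by (subst Suc.IH) auto
  also have "q * ((\<Prod>i<N. q - 1 - real i) * Gamma (y - 1 - real N) * rGamma (y - 1 - (q - 1))) =
     (\<Prod>i<Suc N. q - real i) * Gamma (y - real (Suc N)) * rGamma (y - q)"
    by (simp add: prod.lessThan_Suc_shift algebra_simps del: prod.lessThan_Suc)
  finally show ?case .
qed

text \<open>\<open>oddfact n\<close> is (2n-1)!!; the missing even factors multiply to 2^n
  n!.\<close>

lemma oddfact_eq: "oddfact n = fact (2 * n) / (2 ^ n * fact n)"
proof -
  have "oddfact n * (2 ^ n * fact n) = fact (2 * n)"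
  proof (induction n)
    case 0
    show ?case by (simp add: oddfact_def)
  next
    case (Suc n)
    have "oddfact (Suc n) * (2 ^ Suc n * fact (Suc n)) =
        (2 * real n + 1) * (2 * real n + 2) * (oddfact n * (2 ^ n * fact n))"
      by (simp add: oddfact_def algebra_simps)
    thus ?case unfolding Suc.IH by (simp add: algebra_simps)
  qed
  thus ?thesis by (simp add: field_simps)
qed

lemma prod_arith_2: "(\<Prod>r<n. x + 2 * real r) = 2 ^ n * pochhammer (x / 2) n"
  by (induction n) (simp_all add: pochhammer_rec' field_simps)

lemma prod_arith_2_Gamma:
  assumes "x > 0"
  shows "(\<Prod>r<n. x + 2 * real r) = 2 ^ n * Gamma (x / 2 + real n) / Gamma (x / 2)"
  using assms by (simp add: prod_arith_2 pochhammer_Gamma pos_notin_nonpos_Ints)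

lemma Gamma_half_oddfact: "Gamma (real n + 1 / 2) = sqrt pi * oddfact n / 2 ^ n"
proof -
  have "oddfact n = (\<Prod>r<n. 1 + 2 * real r)" by (simp add: oddfact_def add.commute)
  also have "\<dots> = 2 ^ n * Gamma (1 / 2 + real n) / Gamma (1 / 2)" by (rule prod_arith_2_Gamma) simp
  finally show ?thesis by (simp add: Gamma_one_half_real field_simps)
qed

section \<open>Moments against a Gegenbauer polynomial\<close>

text \<open>For k \<ge> 1 it agrees with \<open>gegen d k\<close> on [-1, 1], but it is continuous
  on the whole line even when d = 1, so integrability on the sphere is immediate.\<close>

definition gegen_poly :: "nat \<Rightarrow> nat \<Rightarrow> real \<Rightarrow> real" where
  "gegen_poly d k t = (\<Sum>s\<le>k div 2. geg_coef d k s * t ^ (k - 2 * s))"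

lemma continuous_on_gegen_poly [continuous_intros]:
  "continuous_on A f \<Longrightarrow> continuous_on A (\<lambda>x. gegen_poly d k (f x))"
  unfolding gegen_poly_def by (intro continuous_intros)

lemma unif_sphere_mixed_moment_odd:
  fixes v \<mu> :: "real^'n::finite"
  assumes "odd (m + p)"
  shows "(\<integral>x. (v \<bullet> x) ^ m * (\<mu> \<bullet> x) ^ p \<partial>unif_sphere) = 0"
proof -
  have "orthogonal_transformation (\<lambda>x :: real^'n. - x)"
    by (simp add: orthogonal_transformation_def linear_uminus)
  hence "(\<integral>x. (v \<bullet> (- x)) ^ m * (\<mu> \<bullet> (- x)) ^ p \<partial>unif_sphere) = (\<integral>x. (v \<bullet> x) ^ m * (\<mu> \<bullet> x) ^ p \<partial>unif_sphere)"
    by (rule integral_unif_sphere_orthogonal) simp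
  moreover have "(v \<bullet> (- x)) ^ m * (\<mu> \<bullet> (- x)) ^ p = - ((v \<bullet> x) ^ m * (\<mu> \<bullet> x) ^ p)" for x
    using assms by (cases "even m") auto
  ultimately show ?thesis by simp
qed

lemma gegen_moment_sum:
  fixes v \<mu> :: "real^'n::finite"
  shows "(\<integral>x. (v \<bullet> x) ^ m * gegen_poly d k (\<mu> \<bullet> x) \<partial>unif_sphere) =
    (\<Sum>s\<le>k div 2. geg_coef d k s * (\<integral>x. (v \<bullet> x) ^ m * (\<mu> \<bullet> x) ^ (k - 2 * s) \<partial>unif_sphere))"
proof -
  have "(\<integral>x. (v \<bullet> x) ^ m * gegen_poly d k (\<mu> \<bullet> x) \<partial>unif_sphere) =
     (\<integral>x. (\<Sum>s\<le>k div 2. geg_coef d k s * ((v \<bullet> x) ^ m * (\<mu> \<bullet> x) ^ (k - 2 * s))) \<partial>unif_sphere)"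
    by (simp add: gegen_poly_def sum_distrib_left mult_ac)
  also have "\<dots> = (\<Sum>s\<le>k div 2. geg_coef d k s * (\<integral>x. (v \<bullet> x) ^ m * (\<mu> \<bullet> x) ^ (k - 2 * s) \<partial>unif_sphere))"
    by (subst Bochner_Integration.integral_sum)
       (auto intro!: integrable_mult_right integrable_unif_sphere_powers)
  finally show ?thesis .
qed

lemma gegen_moment_odd:
  fixes v \<mu> :: "real^'n::finite"
  assumes "odd (m + k)"
  shows "(\<integral>x. (v \<bullet> x) ^ m * gegen_poly d k (\<mu> \<bullet> x) \<partial>unif_sphere) = 0"
  unfolding gegen_moment_sum
proof (intro sum.neutral ballI)
  fix s assume "s \<in> {..k div 2}"
  hence "odd (m + (k - 2 * s))" using assms by auto
  thus "geg_coef d k s * (\<integral>x. (v \<bullet> x) ^ m * (\<mu> \<bullet> x) ^ (k - 2 * s) \<partial>unif_sphere) = 0"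
    by (simp add: unif_sphere_mixed_moment_odd)
qed

lemma kappa_fact:
  assumes "D \<ge> 1"
  shows "kappa D n * (fact n / fact (2 * n)) = Gamma (real D / 2) * rGamma (real D / 2 + real n) / 4 ^ n"
proof -
  have "(4::real) ^ n = 2 ^ n * 2 ^ n" by (simp flip: power_mult_distrib)
  moreover have D: "real D > 0" using assms by simp
  moreover have "Gamma (real D / 2 + real n) \<noteq> 0" "Gamma (real D / 2) \<noteq> 0"
    using D by (auto intro!: less_imp_neq[symmetric] Gamma_real_pos add_pos_nonneg)
  ultimately show ?thesis
    unfolding kappa_def prod_arith_2_Gamma[OF D] oddfact_eq rGamma_inverse_Gamma by (simp add: field_simps)
qed

section \<open>Pairings in degree at most k: orthogonality and the leading term\<close>

text \<open>Here e is half the degree gap. After the two sums are exchanged, 1/(s! (e+j-s)!) is a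
  binomial coefficient over (e+j)!, and the inner sum over s becomes
  \<open>alternating_Gamma_sum\<close> with N = e + j and q = e - 1.\<close>

lemma gegen_moment_le:
  fixes v \<mu> :: "real^'n::finite"
  assumes D: "CARD('n) = d + 1" and d: "d \<ge> 1" and k: "k \<ge> 1" and \<mu>: "norm \<mu> = 1" and e: "m + 2 * e = k"
  defines "y \<equiv> (real d - 1) / 2 + real k"
  shows "(\<integral>x. (v \<bullet> x) ^ m * gegen_poly d k (\<mu> \<bullet> x) \<partial>unif_sphere) =
    g_kd k d * Gamma ((real d + 1) / 2) * fact m * 4 ^ e / 2 ^ k *
    (\<Sum>j\<le>m div 2. (2 * (v \<bullet> \<mu>)) ^ (m - 2 * j) * (v \<bullet> v) ^ j / (fact j * fact (m - 2 * j)) *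
       ((\<Prod>i<e + j. real e - 1 - real i) * Gamma (y - real (e + j)) * rGamma (y - (real e - 1)) / fact (e + j)))"
proof -
  let ?c = "g_kd k d * Gamma ((real d + 1) / 2) * fact m * 4 ^ e / 2 ^ k"
  let ?A = "\<lambda>j. (2 * (v \<bullet> \<mu>)) ^ (m - 2 * j) * (v \<bullet> v) ^ j / (fact j * fact (m - 2 * j))"
  let ?t = "\<lambda>N s. (-1) ^ s * real (N choose s) * (Gamma (y - real s) * rGamma (y - real s - (real e - 1)))"
  have rearrange: "g * sg * P * G / (fs * fp) * (fm * fp * (G' * R / F) * (A / (fj * fe * fmj))) =
      g * G' * fm * (P / F) * (A / (fj * fmj)) * (sg * (1 / (fs * fe)) * (G * R))"
    if "fp \<noteq> 0" for g sg P G fs fp fm G' R F A fj fe fmj :: real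
  proof -
    have "g * sg * P * G / (fs * fp) * (fm * fp * (G' * R / F) * (A / (fj * fe * fmj))) =
        (fp * inverse fp) * (g * G' * fm * (P / F) * (A / (fj * fmj)) * (sg * (1 / (fs * fe)) * (G * R)))"
      by (simp only: divide_inverse inverse_mult_distrib mult_1_left mult_ac)
    thus ?thesis by (simp only: right_inverse[OF that] mult_1_left)
  qed
  have summand: "geg_coef d k s * (\<integral>x. (v \<bullet> x) ^ m * (\<mu> \<bullet> x) ^ (k - 2 * s) \<partial>unif_sphere) =
     (\<Sum>j\<le>m div 2. if s \<le> e + j then ?c * ?A j * (?t (e + j) s / fact (e + j)) else 0)"
    if s: "s \<in> {..k div 2}" for s
  proof -
    define p n where "p = k - 2 * s" and "n = k - s - e"
    have s2: "2 * s \<le> k" and e2: "2 * e \<le> k" using s e by auto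
    have mp: "m + p = 2 * n" using s2 e2 e unfolding p_def n_def by auto
    \<comment> \<open>The powers of two from the polynomial and from the moment combine to a
      constant free of s, which can leave the inner sum.\<close>
    have p4: "(2::real) ^ p / 4 ^ n = 4 ^ e / 2 ^ k"
    proof -
      have "p + k = 2 * n + 2 * e" using s2 e2 unfolding p_def n_def by auto
      hence "(2::real) ^ p * 2 ^ k = 2 ^ (2 * n) * 2 ^ (2 * e)" by (simp only: power_add[symmetric])
      moreover have "(2::real) ^ (2 * i) = 4 ^ i" for i by (simp add: power_mult)
      ultimately show ?thesis by (simp add: field_simps)
    qed
    have arg: "real (d + 1) / 2 + real n = y - real s - (real e - 1)"
      using s2 e2 unfolding y_def n_def by (simp add: of_nat_diff field_simps)
    have K: "kappa CARD('n) n * (fact m * fact p * fact n / fact (2 * n)) =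
        fact m * fact p * (Gamma ((real d + 1) / 2) * rGamma (y - real s - (real e - 1)) / 4 ^ n)"
      using kappa_fact[of "d + 1" n] unfolding D arg by (simp add: field_simps)
    have geg: "geg_coef d k s = g_kd k d * (-1) ^ s * 2 ^ p * Gamma (y - real s) / (fact s * fact p)"
      by (simp add: geg_coef_def p_def y_def)
    have mom: "(\<integral>x. (v \<bullet> x) ^ m * (\<mu> \<bullet> x) ^ p \<partial>unif_sphere) =
        fact m * fact p * (Gamma ((real d + 1) / 2) * rGamma (y - real s - (real e - 1)) / 4 ^ n) *
        (\<Sum>j\<le>m div 2. if m \<le> n + j then
         (2 * (v \<bullet> \<mu>)) ^ (m - 2 * j) * (v \<bullet> v) ^ j / (fact j * fact (n + j - m) * fact (m - 2 * j)) else 0)"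
      unfolding unif_sphere_mixed_moment[OF mp \<mu>] K ..
    show ?thesis
      unfolding p_def[symmetric] mom sum_distrib_left
    proof (intro sum.cong refl)
      fix j assume "j \<in> {..m div 2}"
      have iff: "m \<le> n + j \<longleftrightarrow> s \<le> e + j"
        using s2 e2 e unfolding n_def by auto
      have sub: "n + j - m = e + j - s" if "s \<le> e + j"
        using s2 e2 e that unfolding n_def by auto
      show "geg_coef d k s * (fact m * fact p * (Gamma ((real d + 1) / 2) * rGamma (y - real s - (real e - 1)) / 4 ^ n) *
        (if m \<le> n + j then
         (2 * (v \<bullet> \<mu>)) ^ (m - 2 * j) * (v \<bullet> v) ^ j / (fact j * fact (n + j - m) * fact (m - 2 * j)) else 0)) =
        (if s \<le> e + j then ?c * ?A j * (?t (e + j) s / fact (e + j)) else 0)"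
      proof (cases "s \<le> e + j")
        case True
        have "geg_coef d k s * (fact m * fact p * (Gamma ((real d + 1) / 2) * rGamma (y - real s - (real e - 1)) / 4 ^ n) *
          ((2 * (v \<bullet> \<mu>)) ^ (m - 2 * j) * (v \<bullet> v) ^ j / (fact j * fact (e + j - s) * fact (m - 2 * j)))) =
          g_kd k d * Gamma ((real d + 1) / 2) * fact m * (2 ^ p / 4 ^ n) * ?A j *
          ((-1) ^ s * (1 / (fact s * fact (e + j - s))) * (Gamma (y - real s) * rGamma (y - real s - (real e - 1))))"
          unfolding geg by (rule rearrange) simp
        also have "1 / (fact s * fact (e + j - s)) = real (e + j choose s) / fact (e + j)"
          using True by (simp add: binomial_fact)
        also have "g_kd k d * Gamma ((real d + 1) / 2) * fact m * (2 ^ p / 4 ^ n) * ?A j *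
            ((-1) ^ s * (real (e + j choose s) / fact (e + j)) * (Gamma (y - real s) * rGamma (y - real s - (real e - 1)))) =
            ?c * ?A j * (?t (e + j) s / fact (e + j))"
          unfolding p4 by (simp only: divide_inverse mult_ac)
        finally show ?thesis by (simp only: iff True sub[OF True] if_True)
      qed (simp add: iff)
    qed
  qed
  have "(\<integral>x. (v \<bullet> x) ^ m * gegen_poly d k (\<mu> \<bullet> x) \<partial>unif_sphere) =
      (\<Sum>s\<le>k div 2. \<Sum>j\<le>m div 2. if s \<le> e + j then ?c * ?A j * (?t (e + j) s / fact (e + j)) else 0)"
    unfolding gegen_moment_sum by (intro sum.cong refl summand)
  also have "\<dots> = (\<Sum>j\<le>m div 2. \<Sum>s\<le>k div 2. if s \<le> e + j then ?c * ?A j * (?t (e + j) s / fact (e + j)) else 0)"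
    by (rule sum.swap)
  also have "\<dots> = (\<Sum>j\<le>m div 2. ?c * (?A j * ((\<Prod>i<e + j. real e - 1 - real i) * Gamma (y - real (e + j)) * rGamma (y - (real e - 1)) / fact (e + j))))"
  proof (intro sum.cong refl)
    fix j assume j: "j \<in> {..m div 2}"
    hence N: "e + j \<le> k div 2" "2 * (e + j) \<le> k" using e by auto
    have "y > real (e + j)"
    proof -
      have "2 * real (e + j) \<le> real k" using N(2) by (metis of_nat_le_iff of_nat_mult of_nat_numeral)
      moreover have "real k \<ge> 1" "(real d - 1) / 2 \<ge> 0" using d k by auto
      moreover have "2 * x \<le> K \<Longrightarrow> K \<ge> 1 \<Longrightarrow> A \<ge> 0 \<Longrightarrow> x < A + K" for x K A :: real by linarith
      ultimately show ?thesis unfolding y_def by blast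
    qed
    note * = alternating_Gamma_sum[OF this, of "real e - 1"]
    have "(\<Sum>s\<le>k div 2. if s \<le> e + j then ?c * ?A j * (?t (e + j) s / fact (e + j)) else 0) =
        (\<Sum>s\<le>e + j. ?c * ?A j * (?t (e + j) s / fact (e + j)))"
      using N(1) by (intro sum.mono_neutral_cong_right) auto
    also have "\<dots> = ?c * ?A j * ((\<Sum>s\<le>e + j. ?t (e + j) s) / fact (e + j))"
      by (simp only: sum_distrib_left sum_divide_distrib)
    finally show "(\<Sum>s\<le>k div 2. if s \<le> e + j then ?c * ?A j * (?t (e + j) s / fact (e + j)) else 0) =
       ?c * (?A j * ((\<Prod>i<e + j. real e - 1 - real i) * Gamma (y - real (e + j)) * rGamma (y - (real e - 1)) / fact (e + j)))"
      unfolding * by (simp only: mult.assoc)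
  qed
  finally show ?thesis by (simp only: sum_distrib_left)
qed

lemma gegen_moment_less:
  fixes v \<mu> :: "real^'n::finite"
  assumes "CARD('n) = d + 1" "d \<ge> 1" "norm \<mu> = 1" "m < k"
  shows "(\<integral>x. (v \<bullet> x) ^ m * gegen_poly d k (\<mu> \<bullet> x) \<partial>unif_sphere) = 0"
proof (cases "odd (m + k)")
  case True
  thus ?thesis by (rule gegen_moment_odd)
next
  case False
  hence "even (k - m)" using assms by auto
  then obtain e where "k - m = 2 * e" by (elim evenE)
  hence e: "m + 2 * e = k" "e \<ge> 1" using assms by auto
  \<comment> \<open>The factor with i = e - 1 is zero; it lies in the range because e \<ge>
    1.\<close>
  have Z: "(\<Prod>i<e + j. real e - 1 - real i) = 0" for j
    using e(2) by (intro prod_zero bexI[of _ "e - 1"]) (auto simp: of_nat_diff)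
  have "k \<ge> 1" using assms by simp
  show ?thesis
    unfolding gegen_moment_le[OF assms(1,2) \<open>k \<ge> 1\<close> assms(3) e(1)] Z by simp
qed

text \<open>With e = 0 the product is (-1)(-2)...(-j) = (-1)^j j!, and the remaining Gamma quotient
  is 2^j over y times the denominator of \<open>a_coef d k j\<close>.\<close>

lemma gegen_moment_eq:
  fixes v \<mu> :: "real^'n::finite"
  assumes "CARD('n) = d + 1" "d \<ge> 1" "k \<ge> 1" "norm \<mu> = 1"
  shows "(\<integral>x. (v \<bullet> x) ^ k * gegen_poly d k (\<mu> \<bullet> x) \<partial>unif_sphere) =
    g_kd k d * Gamma ((real d + 1) / 2) / ((real d - 1) / 2 + real k) *
    (\<Sum>j\<le>k div 2. a_coef d k j * ((v \<bullet> v) ^ j * (v \<bullet> \<mu>) ^ (k - 2 * j)))"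
proof -
  define y where "y = (real d - 1) / 2 + real k"
  have y: "y > 0" using assms by (auto simp: y_def intro!: add_nonneg_pos)
  have "(\<integral>x. (v \<bullet> x) ^ k * gegen_poly d k (\<mu> \<bullet> x) \<partial>unif_sphere) =
    g_kd k d * Gamma ((real d + 1) / 2) * fact k * 4 ^ 0 / 2 ^ k *
    (\<Sum>j\<le>k div 2. (2 * (v \<bullet> \<mu>)) ^ (k - 2 * j) * (v \<bullet> v) ^ j / (fact j * fact (k - 2 * j)) *
       ((\<Prod>i<0 + j. real 0 - 1 - real i) * Gamma (y - real (0 + j)) * rGamma (y - (real 0 - 1)) / fact (0 + j)))"
    unfolding y_def by (rule gegen_moment_le[OF assms]) simp
  also have "\<dots> = g_kd k d * Gamma ((real d + 1) / 2) / y *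
     (\<Sum>j\<le>k div 2. a_coef d k j * ((v \<bullet> v) ^ j * (v \<bullet> \<mu>) ^ (k - 2 * j)))"
    unfolding sum_distrib_left
  proof (intro sum.cong refl)
    fix j assume "j \<in> {..k div 2}"
    hence j: "2 * j \<le> k" by auto
    have P1: "(\<Prod>i<0 + j. real 0 - 1 - real i) = (-1) ^ j * fact j"
      by (induction j) (simp_all add: algebra_simps)
    have yj: "y - real j > 0"
    proof -
      have "2 * real j \<le> real k" using j by (metis of_nat_le_iff of_nat_mult of_nat_numeral)
      moreover have "real k \<ge> 1" "(real d - 1) / 2 \<ge> 0" using assms by auto
      ultimately show ?thesis unfolding y_def by linarith
    qed
    \<comment> \<open>The denominator of \<open>a_coef\<close>: its factors are 2(y - r), and read
      backwards they form a rising factorial starting at y - j.\<close>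
    define Q where "Q = (\<Prod>r\<in>{1..j}. 2 * (real k - real r) + real d - 1)"
    have Q: "Q = 2 ^ j * pochhammer (y - real j) j"
    proof -
      have "Q = (\<Prod>r\<in>{1..j}. 2 * (y - real r))"
        unfolding Q_def y_def by (intro prod.cong refl) (simp add: field_simps)
      also have "\<dots> = (\<Prod>i\<in>{0..<j}. 2 * (y - real j + real i))"
        by (rule prod.reindex_bij_witness[of _ "\<lambda>i. j - i" "\<lambda>r. j - r"]) (auto simp: of_nat_diff)
      also have "\<dots> = 2 ^ j * pochhammer (y - real j) j"
        by (simp only: prod.distrib) (simp add: pochhammer_prod)
      finally show ?thesis .
    qed
    have poch: "pochhammer (y - real j) j = Gamma y / Gamma (y - real j)"
      using yj by (simp add: pochhammer_Gamma pos_notin_nonpos_Ints)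
    have nz: "Gamma y \<noteq> 0" "Gamma (y - real j) \<noteq> 0" "y \<noteq> 0"
      using y yj by (auto intro!: less_imp_neq[symmetric] Gamma_real_pos)
    have rG: "rGamma (y - (real 0 - 1)) = 1 / (y * Gamma y)"
    proof -
      have "y - (real 0 - 1) = y + 1" by simp
      moreover have "Gamma (y + 1) = y * Gamma y"
        using y by (intro Gamma_plus1 pos_notin_nonpos_Ints)
      ultimately show ?thesis by (simp only: rGamma_inverse_Gamma divide_inverse mult_1_left)
    qed
    have G: "Gamma (y - real (0 + j)) * rGamma (y - (real 0 - 1)) = 2 ^ j / (y * Q)"
      unfolding Q poch rG using nz by simp
    have "(2::real) ^ k = 2 ^ (k - 2 * j) * (2 ^ j * 2 ^ j)"
      using j by (simp flip: power_add)
    hence pw: "(2 * (v \<bullet> \<mu>)) ^ (k - 2 * j) / 2 ^ k = (v \<bullet> \<mu>) ^ (k - 2 * j) / (2 ^ j * 2 ^ j)"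
      by (simp add: power_mult_distrib)
    have "g_kd k d * Gamma ((real d + 1) / 2) * fact k * 4 ^ 0 / 2 ^ k *
      ((2 * (v \<bullet> \<mu>)) ^ (k - 2 * j) * (v \<bullet> v) ^ j / (fact j * fact (k - 2 * j)) *
       ((\<Prod>i<0 + j. real 0 - 1 - real i) * Gamma (y - real (0 + j)) * rGamma (y - (real 0 - 1)) / fact (0 + j))) =
      g_kd k d * Gamma ((real d + 1) / 2) * fact k * ((2 * (v \<bullet> \<mu>)) ^ (k - 2 * j) / 2 ^ k) * (v \<bullet> v) ^ j / (fact j * fact (k - 2 * j)) *
       ((-1) ^ j * (Gamma (y - real (0 + j)) * rGamma (y - (real 0 - 1))))"
      unfolding P1 by simp
    also have "\<dots> = g_kd k d * Gamma ((real d + 1) / 2) / y * (a_coef d k j * ((v \<bullet> v) ^ j * (v \<bullet> \<mu>) ^ (k - 2 * j)))"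
      unfolding pw G a_coef_def Q_def[symmetric] by (simp add: mult_ac)
    finally show "g_kd k d * Gamma ((real d + 1) / 2) * fact k * 4 ^ 0 / 2 ^ k *
      ((2 * (v \<bullet> \<mu>)) ^ (k - 2 * j) * (v \<bullet> v) ^ j / (fact j * fact (k - 2 * j)) *
       ((\<Prod>i<0 + j. real 0 - 1 - real i) * Gamma (y - real (0 + j)) * rGamma (y - (real 0 - 1)) / fact (0 + j))) =
      g_kd k d * Gamma ((real d + 1) / 2) / y * (a_coef d k j * ((v \<bullet> v) ^ j * (v \<bullet> \<mu>) ^ (k - 2 * j)))" .
  qed
  finally show ?thesis unfolding y_def .
qed

text \<open>With a = (d-1)/2 > 0 the left factor is a/(a+k) and \<open>dkd k d\<close> is (1 + k/a)
  times the value at 1; for d = 1 both sides are 1/2.\<close>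

lemma gegen_at_1_dkd:
  assumes "d \<ge> 1" "k \<ge> 1"
  shows "g_kd k d * Gamma ((real d + 1) / 2) / ((real d - 1) / 2 + real k) / gegen d k 1 = 1 / dkd k d"
proof (cases "d = 1")
  case True
  thus ?thesis using assms by (simp add: g_kd_def gegen_def dkd_def)
next
  case False
  define a where "a = (real d - 1) / 2"
  have a: "a > 0" using assms False by (simp add: a_def)
  have d: "real d - 1 = 2 * a" "(real d + 1) / 2 = a + 1" by (simp_all add: a_def field_simps)
  have "Gamma (a + 1) = a * Gamma a" using a by (intro Gamma_plus1 pos_notin_nonpos_Ints)
  moreover have "Gamma a \<noteq> 0" "Gamma (2 * a) \<noteq> 0" "Gamma (2 * a + real k) \<noteq> 0"
    using a by (auto intro!: less_imp_neq[symmetric] Gamma_real_pos add_pos_nonneg)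
  moreover have "a + real k > 0" using a by simp
  ultimately show ?thesis using a False
    unfolding g_kd_def gegen_def dkd_def d by (simp add: gegen_gf_at_1) (simp add: field_simps)
qed

section \<open>Tangent and normal components relative to the mean direction\<close>

text \<open>Orthogonality leaves only the term j = i. As for independent Gaussians, the result is a
  product of double factorials, divided by the radial factor D(D+2)...(D+2n-2) written with Gamma
  values.\<close>

lemma unif_sphere_mixed_moment_orthogonal:
  fixes \<eta> \<mu> :: "real^'n::finite"
  assumes ip: "2 * i + p = 2 * n" and \<mu>: "norm \<mu> = 1" and orth: "\<eta> \<bullet> \<mu> = 0"
  shows "(\<integral>x. (\<eta> \<bullet> x) ^ (2 * i) * (\<mu> \<bullet> x) ^ p \<partial>unif_sphere) =
    Gamma (real CARD('n) / 2) * rGamma (real CARD('n) / 2 + real n) / 2 ^ n * (oddfact i * oddfact (n - i)) * (\<eta> \<bullet> \<eta>) ^ i"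
proof -
  have i: "i \<le> n" and p: "p = 2 * (n - i)" using ip by auto
  have sum: "(\<Sum>j\<le>2 * i div 2. if 2 * i \<le> n + j then
       (2 * (\<eta> \<bullet> \<mu>)) ^ (2 * i - 2 * j) * (\<eta> \<bullet> \<eta>) ^ j / (fact j * fact (n + j - 2 * i) * fact (2 * i - 2 * j)) else 0) =
     (\<eta> \<bullet> \<eta>) ^ i / (fact i * fact (n - i))"
  proof -
    have "(\<Sum>j\<le>2 * i div 2. if 2 * i \<le> n + j then
       (2 * (\<eta> \<bullet> \<mu>)) ^ (2 * i - 2 * j) * (\<eta> \<bullet> \<eta>) ^ j / (fact j * fact (n + j - 2 * i) * fact (2 * i - 2 * j)) else 0) =
       (\<Sum>j\<le>i. if j = i then (\<eta> \<bullet> \<eta>) ^ i / (fact i * fact (n - i)) else 0)"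
      using i orth by (intro sum.cong) (auto simp: power_0_left mult_2)
    thus ?thesis by simp
  qed
  have K: "kappa CARD('n) n * (fact n / fact (2 * n)) = Gamma (real CARD('n) / 2) * rGamma (real CARD('n) / 2 + real n) / 4 ^ n"
    by (rule kappa_fact) simp
  have "(2::real) ^ i * 2 ^ (n - i) = 2 ^ n" using i by (simp flip: power_add)
  moreover have "(4::real) ^ n = 2 ^ n * 2 ^ n" by (simp flip: power_mult_distrib)
  ultimately have "(4::real) ^ n = 2 ^ n * (2 ^ i * 2 ^ (n - i))" by simp
  hence pw: "1 / (4::real) ^ n = 1 / 2 ^ n * (1 / (2 ^ i * 2 ^ (n - i)))" by simp
  have "(\<integral>x. (\<eta> \<bullet> x) ^ (2 * i) * (\<mu> \<bullet> x) ^ p \<partial>unif_sphere) =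
     kappa CARD('n) n * (fact n / fact (2 * n)) * (fact (2 * i) * fact p) * ((\<eta> \<bullet> \<eta>) ^ i / (fact i * fact (n - i)))"
    unfolding unif_sphere_mixed_moment[OF ip \<mu>] sum by simp
  also have "\<dots> = Gamma (real CARD('n) / 2) * rGamma (real CARD('n) / 2 + real n) * (1 / 4 ^ n) * (fact (2 * i) * fact p) * ((\<eta> \<bullet> \<eta>) ^ i / (fact i * fact (n - i)))"
    unfolding K by simp
  also have "\<dots> = Gamma (real CARD('n) / 2) * rGamma (real CARD('n) / 2 + real n) / 2 ^ n * (oddfact i * oddfact (n - i)) * (\<eta> \<bullet> \<eta>) ^ i"
    unfolding pw p oddfact_eq by simp
  finally show ?thesis .
qed

text \<open>For odd i every term keeps a positive power of \<open>\<eta> \<bullet> \<mu>\<close>,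
  which is zero.\<close>

lemma unif_sphere_mixed_moment_orthogonal_odd:
  fixes \<eta> \<mu> :: "real^'n::finite"
  assumes i: "odd i" and \<mu>: "norm \<mu> = 1" and orth: "\<eta> \<bullet> \<mu> = 0"
  shows "(\<integral>x. (\<eta> \<bullet> x) ^ i * (\<mu> \<bullet> x) ^ p \<partial>unif_sphere) = 0"
proof (cases "odd (i + p)")
  case True
  thus ?thesis by (rule unif_sphere_mixed_moment_odd)
next
  case False
  hence "even (i + p)" by simp
  then obtain n where "i + p = 2 * n" by (elim evenE)
  note * = unif_sphere_mixed_moment[OF this \<mu>, of \<eta>]
  have "(\<Sum>j\<le>i div 2. if i \<le> n + j then
       (2 * (\<eta> \<bullet> \<mu>)) ^ (i - 2 * j) * (\<eta> \<bullet> \<eta>) ^ j / (fact j * fact (n + j - i) * fact (i - 2 * j)) else 0) = 0"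
  proof (intro sum.neutral ballI)
    fix j assume "j \<in> {..i div 2}"
    moreover have "2 * (i div 2) < i" using i by (auto elim: oddE)
    ultimately have "i - 2 * j > 0" by auto
    thus "(if i \<le> n + j then
       (2 * (\<eta> \<bullet> \<mu>)) ^ (i - 2 * j) * (\<eta> \<bullet> \<eta>) ^ j / (fact j * fact (n + j - i) * fact (i - 2 * j)) else 0) = 0"
      using orth by simp
  qed
  thus ?thesis unfolding * by simp
qed

lemma sum_even_reindex:
  fixes h :: "nat \<Rightarrow> real"
  assumes "\<And>i. odd i \<Longrightarrow> h i = 0"
  shows "(\<Sum>i\<le>m. h i) = (\<Sum>j\<le>m div 2. h (2 * j))"
proof -
  have "(\<Sum>i\<le>m. h i) = (\<Sum>i\<in>{i. i \<le> m \<and> even i}. h i)"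
    by (rule sum.mono_neutral_right) (auto simp: assms)
  also have "\<dots> = (\<Sum>j\<le>m div 2. h (2 * j))"
    by (rule sum.reindex_bij_witness[of _ "\<lambda>j. 2 * j" "\<lambda>i. i div 2"]) auto
  finally show ?thesis .
qed

text \<open>Write v = a mu + eta with eta orthogonal to mu and expand binomially; odd powers of the
  tangential part integrate to zero, and eta has squared length
  \<open>v \<bullet> v - (v \<bullet> \<mu>) ^ 2\<close>.\<close>

lemma unif_sphere_mixed_moment_tangent_normal:
  fixes v \<mu> :: "real^'n::finite"
  assumes mp: "m + p = 2 * n" and \<mu>: "norm \<mu> = 1"
  shows "(\<integral>x. (v \<bullet> x) ^ m * (\<mu> \<bullet> x) ^ p \<partial>unif_sphere) =
    (\<Sum>j\<le>m div 2. real (m choose (2 * j)) * ((v \<bullet> \<mu>) ^ (m - 2 * j) * (v \<bullet> v - (v \<bullet> \<mu>) ^ 2) ^ j) *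
      (Gamma (real CARD('n) / 2) * rGamma (real CARD('n) / 2 + real n) / 2 ^ n * (oddfact j * oddfact (n - j))))"
proof -
  define a where "a = v \<bullet> \<mu>"
  define \<eta> where "\<eta> = v - a *\<^sub>R \<mu>"
  have \<mu>\<mu>: "\<mu> \<bullet> \<mu> = 1" using \<mu> by (simp add: dot_square_norm)
  have orth: "\<eta> \<bullet> \<mu> = 0" by (simp add: \<eta>_def a_def inner_diff_left \<mu>\<mu>)
  have \<eta>\<eta>: "\<eta> \<bullet> \<eta> = v \<bullet> v - (v \<bullet> \<mu>) ^ 2"
    by (simp add: \<eta>_def a_def inner_diff_left inner_diff_right \<mu>\<mu> inner_commute[of \<mu> v] power2_eq_square)
  have expand: "(v \<bullet> x) ^ m * (\<mu> \<bullet> x) ^ p =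
      (\<Sum>i\<le>m. real (m choose i) * a ^ (m - i) * ((\<eta> \<bullet> x) ^ i * (\<mu> \<bullet> x) ^ (m - i + p)))" for x
  proof -
    have eq: "v \<bullet> x = \<eta> \<bullet> x + a * (\<mu> \<bullet> x)" by (simp add: \<eta>_def inner_diff_left)
    show ?thesis
      unfolding eq binomial_ring sum_distrib_right
      by (intro sum.cong refl) (simp only: power_mult_distrib power_add mult_ac)
  qed
  have "(\<integral>x. (v \<bullet> x) ^ m * (\<mu> \<bullet> x) ^ p \<partial>unif_sphere) =
     (\<Sum>i\<le>m. real (m choose i) * a ^ (m - i) * (\<integral>x. (\<eta> \<bullet> x) ^ i * (\<mu> \<bullet> x) ^ (m - i + p) \<partial>unif_sphere))"
    unfolding expand
    by (subst Bochner_Integration.integral_sum)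
       (auto intro!: integrable_mult_right integrable_unif_sphere_powers)
  also have "\<dots> = (\<Sum>j\<le>m div 2. real (m choose (2 * j)) * a ^ (m - 2 * j) * (\<integral>x. (\<eta> \<bullet> x) ^ (2 * j) * (\<mu> \<bullet> x) ^ (m - 2 * j + p) \<partial>unif_sphere))"
    by (rule sum_even_reindex) (simp add: unif_sphere_mixed_moment_orthogonal_odd[OF _ \<mu> orth])
  also have "\<dots> = (\<Sum>j\<le>m div 2. real (m choose (2 * j)) * ((v \<bullet> \<mu>) ^ (m - 2 * j) * (v \<bullet> v - (v \<bullet> \<mu>) ^ 2) ^ j) *
      (Gamma (real CARD('n) / 2) * rGamma (real CARD('n) / 2 + real n) / 2 ^ n * (oddfact j * oddfact (n - j))))"
  proof (intro sum.cong refl)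
    fix j assume "j \<in> {..m div 2}"
    hence "2 * j + (m - 2 * j + p) = 2 * n" using mp by auto
    from unif_sphere_mixed_moment_orthogonal[OF this \<mu> orth]
    show "real (m choose (2 * j)) * a ^ (m - 2 * j) * (\<integral>x. (\<eta> \<bullet> x) ^ (2 * j) * (\<mu> \<bullet> x) ^ (m - 2 * j + p) \<partial>unif_sphere) =
      real (m choose (2 * j)) * ((v \<bullet> \<mu>) ^ (m - 2 * j) * (v \<bullet> v - (v \<bullet> \<mu>) ^ 2) ^ j) *
      (Gamma (real CARD('n) / 2) * rGamma (real CARD('n) / 2 + real n) / 2 ^ n * (oddfact j * oddfact (n - j)))"
      unfolding \<eta>\<eta> by (simp add: a_def)
  qed
  finally show ?thesis .
qed

text \<open>The quotient is 1/B(1/2, d/2), the normalizing constant of (1-t^2)^(d/2-1) on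
  [-1, 1].\<close>

lemma omega_ratio:
  assumes "d \<ge> 1"
  shows "omega (d - 1) / omega d = Gamma ((real d + 1) / 2) / (sqrt pi * Gamma (real d / 2))"
proof -
  have "pi powr ((real d + 1) / 2) = pi powr (real d / 2) * sqrt pi"
    by (simp add: add_divide_distrib powr_add powr_half_sqrt)
  moreover have "real (d - 1) + 1 = real d" using assms by simp
  ultimately show ?thesis by (simp add: omega_def)
qed

text \<open>This stands in for the tangent-normal change of variables: the moment weight equals a
  Beta integral in t = \<open>\<mu> \<bullet> x\<close>. Together with \<open>oddfact j\<close>, the
  product over d + 2r is \<open>kappa d j\<close>, the moment constant of the equatorial
  sphere.\<close>

lemma Beta_omega:
  assumes d: "d \<ge> 1" and j: "j \<le> n"
  shows "Gamma (real (d + 1) / 2) * rGamma (real (d + 1) / 2 + real n) / 2 ^ n * oddfact (n - j) =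
    omega (d - 1) / omega d / (\<Prod>r<j. real d + 2 * real r) * Beta (real (n - j) + 1 / 2) (real d / 2 + real j)"
proof -
  have d': "real d > 0" using d by simp
  have nz: "Gamma (real d / 2) \<noteq> 0" "Gamma (real d / 2 + real j) \<noteq> 0"
    using d' by (auto intro!: less_imp_neq[symmetric] Gamma_real_pos add_pos_nonneg)
  have pw: "(2::real) ^ n = 2 ^ (n - j) * 2 ^ j" using j by (simp flip: power_add)
  have arg: "real (n - j) + 1 / 2 + (real d / 2 + real j) = real (d + 1) / 2 + real n"
    using j by (simp add: of_nat_diff field_simps)
  have arg': "(real d + 1) / 2 = real (d + 1) / 2" by (simp add: add.commute)
  have rearrange: "G * inverse G' / (A * B) * F = G / (S * g) / (B * gj / g) * (S * F / A * gj / G')"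
    if "g \<noteq> 0" "gj \<noteq> 0" "S \<noteq> 0" for G G' A B F S g gj :: real
  proof -
    have "G / (S * g) / (B * gj / g) * (S * F / A * gj / G') =
        (g * inverse g) * (gj * inverse gj) * (S * inverse S) * (G * inverse G' / (A * B) * F)"
      by (simp only: divide_inverse inverse_mult_distrib inverse_inverse_eq mult_ac)
    thus ?thesis by (simp only: that[THEN right_inverse] mult_1_left)
  qed
  show ?thesis
    unfolding omega_ratio[OF d] prod_arith_2_Gamma[OF d'] Beta_def arg Gamma_half_oddfact arg' pw rGamma_inverse_Gamma
    by (rule rearrange) (use nz in simp_all)
qed

text \<open>Each monomial of the polynomial yields one Beta value; after exchanging the sums, the
  sum over s is the expansion of \<open>f_int\<close> in \<open>f_int_sum\<close>.\<close>

lemma gegen_moment_f_int: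
  fixes v \<mu> :: "real^'n::finite"
  assumes D: "CARD('n) = d + 1" and d: "d \<ge> 1" and k: "k \<ge> 1" and \<mu>: "norm \<mu> = 1" and ev: "even (m + k)"
  shows "(\<integral>x. (v \<bullet> x) ^ m * gegen_poly d k (\<mu> \<bullet> x) \<partial>unif_sphere) =
    omega (d - 1) / omega d * (\<Sum>j\<le>m div 2. real (m choose (2 * j)) * oddfact j / (\<Prod>r<j. real d + 2 * real r) * f_int d k m j *
      ((v \<bullet> \<mu>) ^ (m - 2 * j) * (v \<bullet> v - (v \<bullet> \<mu>) ^ 2) ^ j))"
proof -
  let ?W = "\<lambda>j. (v \<bullet> \<mu>) ^ (m - 2 * j) * (v \<bullet> v - (v \<bullet> \<mu>) ^ 2) ^ j"
  let ?C = "\<lambda>j. omega (d - 1) / omega d * (real (m choose (2 * j)) * oddfact j / (\<Prod>r<j. real d + 2 * real r) * ?W j)"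
  have rearrange: "g * C * W * F * (R / P * B) = R * (C * F / P * W) * (g * B)"
    for g C W F R P B :: real
    by (simp only: divide_inverse mult_ac)
  obtain c where c: "m + k = 2 * c" using ev by (elim evenE)
  have c': "(m + k) div 2 = c" using c by simp
  have "(\<integral>x. (v \<bullet> x) ^ m * gegen_poly d k (\<mu> \<bullet> x) \<partial>unif_sphere) =
     (\<Sum>s\<le>k div 2. \<Sum>j\<le>m div 2. ?C j * (geg_coef d k s * Beta (real ((m + k) div 2 - s - j) + 1 / 2) (real d / 2 + real j)))"
    unfolding gegen_moment_sum
  proof (intro sum.cong refl)
    fix s assume s: "s \<in> {..k div 2}"
    hence mp: "m + (k - 2 * s) = 2 * (c - s)" using c by auto
    show "geg_coef d k s * (\<integral>x. (v \<bullet> x) ^ m * (\<mu> \<bullet> x) ^ (k - 2 * s) \<partial>unif_sphere) =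
      (\<Sum>j\<le>m div 2. ?C j * (geg_coef d k s * Beta (real ((m + k) div 2 - s - j) + 1 / 2) (real d / 2 + real j)))"
      unfolding unif_sphere_mixed_moment_tangent_normal[OF mp \<mu>] sum_distrib_left c' D
    proof (intro sum.cong refl)
      fix j assume "j \<in> {..m div 2}"
      hence j: "j \<le> c - s" using s c by auto
      have "geg_coef d k s * (real (m choose (2 * j)) * ?W j *
          (Gamma (real (d + 1) / 2) * rGamma (real (d + 1) / 2 + real (c - s)) / 2 ^ (c - s) * (oddfact j * oddfact (c - s - j)))) =
          geg_coef d k s * real (m choose (2 * j)) * ?W j * oddfact j *
          (Gamma (real (d + 1) / 2) * rGamma (real (d + 1) / 2 + real (c - s)) / 2 ^ (c - s) * oddfact (c - s - j))"
        by (simp only: mult_ac)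
      also have "\<dots> = ?C j * (geg_coef d k s * Beta (real (c - s - j) + 1 / 2) (real d / 2 + real j))"
        unfolding Beta_omega[OF d j] by (rule rearrange)
      finally show "geg_coef d k s * (real (m choose (2 * j)) * ?W j *
          (Gamma (real (d + 1) / 2) * rGamma (real (d + 1) / 2 + real (c - s)) / 2 ^ (c - s) * (oddfact j * oddfact (c - s - j)))) =
          ?C j * (geg_coef d k s * Beta (real (c - s - j) + 1 / 2) (real d / 2 + real j))" .
    qed
  qed
  also have "\<dots> = (\<Sum>j\<le>m div 2. ?C j * f_int d k m j)"
    by (subst sum.swap) (simp add: f_int_sum[OF d k ev] sum_distrib_left)
  also have "\<dots> = omega (d - 1) / omega d * (\<Sum>j\<le>m div 2. real (m choose (2 * j)) * oddfact j / (\<Prod>r<j. real d + 2 * real r) * f_int d k m j * ?W j)"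
    unfolding sum_distrib_left by (intro sum.cong refl) (simp only: mult_ac)
  finally show ?thesis .
qed

section \<open>Tensor moments\<close>

lemma borel_measurable_arccos: "arccos \<in> borel_measurable borel"
proof -
  define c where "c = (THE x :: real. False)"
  have out: "arccos y = c" if "y \<notin> {-1..1}" for y
  proof -
    \<comment> \<open>Outside [-1, 1] the defining description has no solution, and it is the same
      unsatisfiable predicate for every such y, so \<open>arccos\<close> is constant there.\<close>
    have "(\<lambda>x. 0 \<le> x \<and> x \<le> pi \<and> cos x = y) = (\<lambda>x. False)"
      using that cos_le_one cos_ge_minus_one by auto
    thus ?thesis by (simp add: arccos_def c_def)
  qed
  have "(\<lambda>y. indicator {-1..1} y *\<^sub>R arccos y) \<in> borel_measurable borel"
    by (intro borel_measurable_continuous_on_indicator continuous_on_arccos') auto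
  hence "(\<lambda>y. indicator {-1..1} y *\<^sub>R arccos y + indicator (- {-1..1}) y * c) \<in> borel_measurable borel"
    by measurable
  also have "(\<lambda>y. indicator {-1..1} y *\<^sub>R arccos y + indicator (- {-1..1}) y * c) = arccos"
    using out by (auto simp: indicator_def fun_eq_iff)
  finally show ?thesis .
qed

lemma borel_measurable_gegen:
  assumes "d \<ge> 1"
  shows "gegen d k \<in> borel_measurable borel"
proof (cases "d = 1")
  case True
  note [measurable] = borel_measurable_arccos
  have "gegen d k = (\<lambda>x. cos (real k * arccos x))" using True by (simp add: gegen_def fun_eq_iff)
  thus ?thesis by simp
next
  case False
  have "(real d - 1) / 2 > 0" using assms False by simp
  hence "gegen d k = (\<lambda>x. \<Sum>s\<le>k div 2. (-1) ^ s * 2 ^ (k - 2 * s) * Gamma ((real d - 1) / 2 + real k - real s)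
     / (Gamma ((real d - 1) / 2) * fact s * fact (k - 2 * s)) * x ^ (k - 2 * s))"
    using False by (simp add: gegen_def gegen_gf_explicit fun_eq_iff)
  thus ?thesis by simp
qed

lemma AE_unif_sphere_gegen:
  fixes \<mu> :: "real^'n::finite"
  assumes "d \<ge> 1" "k \<ge> 1" "norm \<mu> = 1"
  shows "AE x in unif_sphere. gegen d k (x \<bullet> \<mu>) = gegen_poly d k (\<mu> \<bullet> x)"
  using AE_unif_sphere
proof eventually_elim
  case (elim x)
  have "\<bar>x \<bullet> \<mu>\<bar> \<le> 1" using Cauchy_Schwarz_ineq2[of x \<mu>] elim assms by simp
  thus ?case using gegen_explicit[OF assms(1,2)] by (simp add: gegen_poly_def inner_commute)
qed

text \<open>The normalization by \<open>omega d\<close> moves into the base measure; almost every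
  point has length one, where \<open>gegen\<close> may be exchanged for the polynomial.\<close>

lemma Cdist_eq_density_unif_sphere:
  fixes \<mu> :: "real^'n::finite"
  assumes D: "CARD('n) = d + 1" and d: "d \<ge> 1" and k: "k \<ge> 1" and \<mu>: "norm \<mu> = 1"
  shows "Cdist k \<mu> \<rho> = density unif_sphere (\<lambda>x. ennreal (1 + \<rho> / gegen d k 1 * gegen_poly d k (\<mu> \<bullet> x)))"
proof -
  note [measurable] = borel_measurable_gegen[OF d]
  have [measurable]: "(\<lambda>x. gegen_poly d k (\<mu> \<bullet> x)) \<in> borel_measurable borel"
    by (intro borel_measurable_continuous_onI continuous_intros)
  have om: "omega d > 0" by (rule omega_pos)
  have "Cdist k \<mu> \<rho> = density sphere_measure (\<lambda>x. ennreal (1 / omega d) * ennreal (1 + \<rho> * gegen_norm d k (x \<bullet> \<mu>)))"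
    unfolding Cdist_def D using om
    by (intro arg_cong2[where f = density] refl ext) (simp flip: ennreal_mult')
  also have "\<dots> = density unif_sphere (\<lambda>x. ennreal (1 + \<rho> * gegen_norm d k (x \<bullet> \<mu>)))"
    unfolding unif_sphere_def D by (subst density_density_eq) (simp_all add: gegen_norm_def)
  also have "\<dots> = density unif_sphere (\<lambda>x. ennreal (1 + \<rho> / gegen d k 1 * gegen_poly d k (\<mu> \<bullet> x)))"
  proof (rule density_cong)
    show "AE x in unif_sphere. ennreal (1 + \<rho> * gegen_norm d k (x \<bullet> \<mu>)) = ennreal (1 + \<rho> / gegen d k 1 * gegen_poly d k (\<mu> \<bullet> x))"
      using AE_unif_sphere_gegen[OF d k \<mu>] by eventually_elim (simp add: gegen_norm_def)
  qed (simp_all add: gegen_norm_def)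
  finally show ?thesis .
qed

text \<open>If a signed density and its positive part both have mass one, then the density is
  nonnegative almost everywhere; this replaces the bound of a Gegenbauer polynomial by its value at 1.\<close>

lemma AE_nonneg_density:
  fixes p :: "'a \<Rightarrow> real"
  assumes int: "integrable N p" and one: "(\<integral>x. p x \<partial>N) = 1"
    and prob: "prob_space (density N (\<lambda>x. ennreal (p x)))"
  shows "AE x in N. 0 \<le> p x"
proof -
  have [measurable]: "p \<in> borel_measurable N" using int by auto
  have "(\<integral>\<^sup>+x. ennreal (max 0 (p x)) \<partial>N) = emeasure (density N (\<lambda>x. ennreal (p x))) (space N)"
    by (subst emeasure_density) (auto intro!: nn_integral_cong simp: ennreal_max_0)
  also have "\<dots> = 1" using prob_space.emeasure_space_1[OF prob] by simp
  finally have "(\<integral>x. max 0 (p x) \<partial>N) = 1"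
    by (subst integral_eq_nn_integral) auto
  moreover have "integrable N (\<lambda>x. max 0 (p x))" using int by simp
  ultimately have "(\<integral>x. max 0 (p x) - p x \<partial>N) = 0" "integrable N (\<lambda>x. max 0 (p x) - p x)"
    using int one by simp_all
  hence "AE x in N. max 0 (p x) - p x = 0"
    by (subst (asm) integral_nonneg_eq_0_iff_AE) auto
  thus ?thesis by eventually_elim auto
qed

lemma continuous_on_tpow: "continuous_on A (\<lambda>x. tpow x is)"
  unfolding tpow_conv_prod by (intro continuous_intros)

lemma integral_Cdist:
  fixes \<mu> :: "real^'n::finite"
  assumes D: "CARD('n) = d + 1" and d: "d \<ge> 1" and k: "k \<ge> 1" and \<mu>: "norm \<mu> = 1"
    and prob: "prob_space (Cdist k \<mu> \<rho>)" and F: "continuous_on UNIV F"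
  shows "(\<integral>x. F x \<partial>(Cdist k \<mu> \<rho>)) =
    (\<integral>x. F x \<partial>unif_sphere) + \<rho> / gegen d k 1 * (\<integral>x. F x * gegen_poly d k (\<mu> \<bullet> x) \<partial>unif_sphere)"
proof -
  interpret U: prob_space "unif_sphere :: (real^'n) measure" by (rule prob_space_unif_sphere)
  define p where "p x = 1 + \<rho> / gegen d k 1 * gegen_poly d k (\<mu> \<bullet> x)" for x
  have dens: "Cdist k \<mu> \<rho> = density unif_sphere (\<lambda>x. ennreal (p x))"
    unfolding p_def by (rule Cdist_eq_density_unif_sphere[OF D d k \<mu>])
  have cont: "continuous_on UNIV p" unfolding p_def by (intro continuous_intros)
  have ip: "integrable unif_sphere p" by (rule integrable_unif_sphere[OF cont])
  have ig: "integrable unif_sphere (\<lambda>x. gegen_poly d k (\<mu> \<bullet> x))"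
    by (intro integrable_unif_sphere continuous_intros)
  \<comment> \<open>Orthogonality in degree zero: the power is constantly 1, so the polynomial has
    mean zero and the signed density has total mass one.\<close>
  have "(\<integral>x. (0 \<bullet> x) ^ 0 * gegen_poly d k (\<mu> \<bullet> x) \<partial>unif_sphere) = 0"
    using k by (intro gegen_moment_less[OF D d \<mu>]) simp
  hence "(\<integral>x. p x \<partial>unif_sphere) = 1"
    unfolding p_def using ig U.prob_space by simp
  hence nn: "AE x in unif_sphere. 0 \<le> p x"
    using AE_nonneg_density[OF ip] prob unfolding dens by simp
  have "(\<integral>x. F x \<partial>(Cdist k \<mu> \<rho>)) = (\<integral>x. p x * F x \<partial>unif_sphere)"
    unfolding dens using borel_measurable_continuous_onI[OF F] borel_measurable_continuous_onI[OF cont] nn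
    by (subst integral_density) simp_all
  also have "\<dots> = (\<integral>x. F x + \<rho> / gegen d k 1 * (F x * gegen_poly d k (\<mu> \<bullet> x)) \<partial>unif_sphere)"
    by (simp add: p_def algebra_simps)
  also have "\<dots> = (\<integral>x. F x \<partial>unif_sphere) + \<rho> / gegen d k 1 * (\<integral>x. F x * gegen_poly d k (\<mu> \<bullet> x) \<partial>unif_sphere)"
  proof -
    have "integrable unif_sphere F" "integrable unif_sphere (\<lambda>x. F x * gegen_poly d k (\<mu> \<bullet> x))"
      using F by (intro integrable_unif_sphere continuous_intros; simp)+
    thus ?thesis by simp
  qed
  finally show ?thesis .
qed

section \<open>Moment tensors and their contractions\<close>

lemma
  fixes h :: "real^'n::finite \<Rightarrow> real"
  assumes h: "continuous_on UNIV h"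
  shows symmetric_tensor_moment: "symmetric_tensor m (\<lambda>is. \<integral>x. tpow x is * h x \<partial>unif_sphere)"
    and contract_moment: "contract m (\<lambda>is. \<integral>x. tpow x is * h x \<partial>unif_sphere) v = (\<integral>x. (v \<bullet> x) ^ m * h x \<partial>unif_sphere)"
proof -
  show "symmetric_tensor m (\<lambda>is. \<integral>x. tpow x is * h x \<partial>unif_sphere)"
    by (simp add: symmetric_tensor_def tpow_reindex_list)
  have "contract m (\<lambda>is. \<integral>x. tpow x is * h x \<partial>unif_sphere) v =
      (\<Sum>is | length is = m. \<integral>x. tpow x is * h x * tpow v is \<partial>unif_sphere)"
    by (simp add: contract_def)
  also have "\<dots> = (\<integral>x. (\<Sum>is | length is = m. tpow x is * h x * tpow v is) \<partial>unif_sphere)"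
    using h by (intro Bochner_Integration.integral_sum[symmetric] integrable_unif_sphere continuous_intros continuous_on_tpow)
  also have "\<dots> = (\<integral>x. (v \<bullet> x) ^ m * h x \<partial>unif_sphere)"
  proof (intro Bochner_Integration.integral_cong refl)
    fix x
    have "(\<Sum>is | length is = m. tpow x is * h x * tpow v is) = contract m (tpow x) v * h x"
      unfolding contract_def sum_distrib_right by (intro sum.cong refl) (simp only: mult_ac)
    thus "(\<Sum>is | length is = m. tpow x is * h x * tpow v is) = (v \<bullet> x) ^ m * h x"
      by (simp add: contract_tpow)
  qed
  finally show "contract m (\<lambda>is. \<integral>x. tpow x is * h x \<partial>unif_sphere) v = (\<integral>x. (v \<bullet> x) ^ m * h x \<partial>unif_sphere)" .
qed

lemma symmetric_tensor_scale: "symmetric_tensor m T \<Longrightarrow> symmetric_tensor m (\<lambda>is. c * T is)"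
  by (simp add: symmetric_tensor_def)

lemma contract_scale: "contract m (\<lambda>is. c * T is) v = c * contract m T v"
  by (simp add: contract_def sum_distrib_left mult.assoc)

lemma symmetric_mu_unif: "symmetric_tensor m (mu_unif d m)"
  using symmetric_tsym[of m "tpowT 2 vecI (m div 2)"]
  by (auto simp: symmetric_tensor_def mu_unif_def)

lemma contract_mu_unif:
  fixes v :: "real^'n::finite"
  shows "contract m (mu_unif d m) v = (if even m then kappa (d + 1) (m div 2) * (v \<bullet> v) ^ (m div 2) else 0)"
proof (cases "even m")
  case True
  hence "(mu_unif d m :: 'n tensor) = (\<lambda>is. kappa (d + 1) (m div 2) * tsym m (tpowT 2 vecI (m div 2)) is)"
    by (simp add: mu_unif_def kappa_def fun_eq_iff add_ac)
  moreover have "contract m (tpowT 2 vecI (m div 2)) v = (v \<bullet> v) ^ (m div 2)"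
    using contract_tpowT[of 2 "m div 2" vecI v] True by (simp add: contract_vecI)
  ultimately show ?thesis using True by (simp add: contract_scale contract_tsym)
qed (simp add: mu_unif_def contract_def)

lemma unif_sphere_tensor_moment:
  fixes "is" :: "'n::finite list"
  assumes D: "CARD('n) = d + 1" and l: "length is = m"
  shows "(\<integral>x. tpow x is \<partial>unif_sphere) = mu_unif d m is"
proof -
  have "(\<lambda>is :: 'n list. \<integral>x. tpow x is * 1 \<partial>unif_sphere) is = mu_unif d m is"
    by (rule symmetric_tensor_eqI[OF symmetric_tensor_moment symmetric_mu_unif _ l])
       (simp_all add: contract_moment[of "\<lambda>_. 1", simplified] contract_mu_unif unif_sphere_moment D)
  thus ?thesis by simp
qed

text \<open>The tensor vec I minus the square of mu contracts to the squared length of the part of v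
  orthogonal to mu; the bound on j makes the degrees add up to m.\<close>

lemma contract_tangent_normal:
  assumes "j \<le> m div 2"
  shows "contract m (tkron (m - 2 * j) (tpow \<mu>) (tpowT 2 (\<lambda>ls. vecI ls - tpow \<mu> ls) j)) v =
    (v \<bullet> \<mu>) ^ (m - 2 * j) * (v \<bullet> v - (v \<bullet> \<mu>) ^ 2) ^ j"
proof -
  have "m - 2 * j + 2 * j = m" using assms by auto
  thus ?thesis
    using contract_tkron[of "m - 2 * j" "2 * j" "tpow \<mu>" "tpowT 2 (\<lambda>ls. vecI ls - tpow \<mu> ls) j" v]
    by (simp add: contract_tpowT contract_diff contract_vecI contract_tpow)
qed

lemma contract_harmonic:
  assumes "j \<le> k div 2"
  shows "contract k (tkron (2 * j) (tpowT 2 vecI j) (tpow \<mu>)) v = (v \<bullet> v) ^ j * (v \<bullet> \<mu>) ^ (k - 2 * j)"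
proof -
  have "2 * j + (k - 2 * j) = k" using assms by auto
  thus ?thesis
    using contract_tkron[of "2 * j" "k - 2 * j" "tpowT 2 vecI j" "tpow \<mu>" v]
    by (simp add: contract_tpowT contract_vecI contract_tpow)
qed

lemma gegen_tensor_moment_zero:
  fixes \<mu> :: "real^'n::finite"
  assumes "CARD('n) = d + 1" "d \<ge> 1" "norm \<mu> = 1" and c: "m < k \<or> odd (m + k)" and l: "length is = m"
  shows "(\<integral>x. tpow x is * gegen_poly d k (\<mu> \<bullet> x) \<partial>unif_sphere) = 0"
proof -
  have cont: "continuous_on UNIV (\<lambda>x. gegen_poly d k (\<mu> \<bullet> x))" by (intro continuous_intros)
  have z: "symmetric_tensor m (\<lambda>_ :: 'n list. 0)" by (simp add: symmetric_tensor_def)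
  have "(\<lambda>is. \<integral>x. tpow x is * gegen_poly d k (\<mu> \<bullet> x) \<partial>unif_sphere) is = (\<lambda>_. 0) is"
  proof (rule symmetric_tensor_eqI[OF symmetric_tensor_moment[OF cont] z _ l])
    fix v
    have "(\<integral>x. (v \<bullet> x) ^ m * gegen_poly d k (\<mu> \<bullet> x) \<partial>unif_sphere) = 0"
      using c gegen_moment_less[OF assms(1-3)] gegen_moment_odd by blast
    thus "contract m (\<lambda>is. \<integral>x. tpow x is * gegen_poly d k (\<mu> \<bullet> x) \<partial>unif_sphere) v = contract m (\<lambda>_. 0) v"
      unfolding contract_moment[OF cont] by (simp add: contract_def)
  qed
  thus ?thesis by simp
qed

lemma gegen_tensor_moment_eq:
  fixes \<mu> :: "real^'n::finite"
  assumes "CARD('n) = d + 1" "d \<ge> 1" "k \<ge> 1" "norm \<mu> = 1" and l: "length is = k"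
  shows "(\<integral>x. tpow x is * gegen_poly d k (\<mu> \<bullet> x) \<partial>unif_sphere) =
    g_kd k d * Gamma ((real d + 1) / 2) / ((real d - 1) / 2 + real k) *
    tsym k (\<lambda>js. \<Sum>j\<le>k div 2. a_coef d k j * tkron (2 * j) (tpowT 2 vecI j) (tpow \<mu>) js) is"
    (is "_ = ?c * tsym k ?T is")
proof -
  have cont: "continuous_on UNIV (\<lambda>x. gegen_poly d k (\<mu> \<bullet> x))" by (intro continuous_intros)
  have "(\<lambda>is. \<integral>x. tpow x is * gegen_poly d k (\<mu> \<bullet> x) \<partial>unif_sphere) is = (\<lambda>is. ?c * tsym k ?T is) is"
    by (rule symmetric_tensor_eqI[OF symmetric_tensor_moment[OF cont] symmetric_tensor_scale[OF symmetric_tsym] _ l])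
       (simp only: contract_moment[OF cont] contract_scale contract_tsym contract_sum
          gegen_moment_eq[OF assms(1-4)], simp add: contract_harmonic)
  thus ?thesis by simp
qed

lemma gegen_tensor_moment_general:
  fixes \<mu> :: "real^'n::finite"
  assumes "CARD('n) = d + 1" "d \<ge> 1" "k \<ge> 1" "norm \<mu> = 1" and l: "length is = m"
  shows "(\<integral>x. tpow x is * gegen_poly d k (\<mu> \<bullet> x) \<partial>unif_sphere) =
    omega (d - 1) / omega d * tsym m (\<lambda>js. \<Sum>j\<le>m div 2. e_coef d k m j *
               tkron (m - 2 * j) (tpow \<mu>) (tpowT 2 (\<lambda>ls. vecI ls - tpow \<mu> ls) j) js) is"
    (is "_ = ?c * tsym m ?T is")
proof (cases "even (m + k)")
  case True
  have cont: "continuous_on UNIV (\<lambda>x. gegen_poly d k (\<mu> \<bullet> x))" by (intro continuous_intros)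
  have "(\<lambda>is. \<integral>x. tpow x is * gegen_poly d k (\<mu> \<bullet> x) \<partial>unif_sphere) is = (\<lambda>is. ?c * tsym m ?T is) is"
    by (rule symmetric_tensor_eqI[OF symmetric_tensor_moment[OF cont] symmetric_tensor_scale[OF symmetric_tsym] _ l])
       (simp only: contract_moment[OF cont] contract_scale contract_tsym contract_sum
          gegen_moment_f_int[OF assms(1-4) True],
        simp add: contract_tangent_normal e_coef_def True[simplified])
  thus ?thesis by simp
next
  case False
  \<comment> \<open>The parity indicator in \<open>e_coef\<close> kills every summand, matching the
    vanishing of the moment under the antipodal map.\<close>
  hence "tsym m ?T is = 0" by (simp add: tsym_def e_coef_def)
  thus ?thesis using gegen_tensor_moment_zero[OF assms(1,2,4) _ l] False by simp
qed

theorem theorem1: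
  fixes M :: "'a measure" and X U :: "'a \<Rightarrow> real^'n" and \<mu> :: "real^'n"
    and \<rho> :: real and d k m :: nat
  assumes "prob_space M"
    and "CARD('n) = d + 1" and "d \<ge> 1" and "k \<ge> 1" and "m \<ge> 1"
    and "norm \<mu> = 1" and "-1 \<le> \<rho>" and "\<rho> \<le> 1"
    and "X \<in> measurable M borel" and "distr M borel X = Cdist k \<mu> \<rho>"
    and "U \<in> measurable M borel" and "distr M borel U = unif_sphere"
  shows "(\<forall>is. length is = m \<longrightarrow> (\<integral>\<omega>. tpow (U \<omega>) is \<partial>M) = mu_unif d m is)
    \<and> (m < k \<longrightarrow> (\<forall>is. length is = m \<longrightarrow> (\<integral>\<omega>. tpow (X \<omega>) is \<partial>M) = mu_unif d m is))
    \<and> (m = k \<longrightarrow> (\<forall>is. length is = k \<longrightarrow> (\<integral>\<omega>. tpow (X \<omega>) is \<partial>M) =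
          mu_unif d k is + \<rho> / dkd k d *
            tsym k (\<lambda>js. \<Sum>j\<le>k div 2. a_coef d k j * tkron (2 * j) (tpowT 2 vecI j) (tpow \<mu>) js) is))
    \<and> (m > k \<and> odd (m - k) \<longrightarrow>
          (\<forall>is. length is = m \<longrightarrow> (\<integral>\<omega>. tpow (X \<omega>) is \<partial>M) = mu_unif d m is))
    \<and> (even (m + k) \<longrightarrow> (\<forall>j\<le>m div 2. f_int d k m j = f_closed d k m j))
    \<and> (\<forall>is. length is = m \<longrightarrow> (\<integral>\<omega>. tpow (X \<omega>) is \<partial>M) =
          mu_unif d m is + \<rho> / gegen d k 1 * (omega (d - 1) / omega d) *
            tsym m (\<lambda>js. \<Sum>j\<le>m div 2. e_coef d k m j *
               tkron (m - 2 * j) (tpow \<mu>) (tpowT 2 (\<lambda>ls. vecI ls - tpow \<mu> ls) j) js) is)"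
proof -
  note D = assms(2) and d = assms(3) and k = assms(4) and \<mu> = assms(6)
  have meas: "(\<lambda>x :: real^'n. tpow x is) \<in> borel_measurable borel" for "is"
    by (intro borel_measurable_continuous_onI continuous_on_tpow)
  have U: "(\<integral>\<omega>. tpow (U \<omega>) is \<partial>M) = mu_unif d m is" if "length is = m" for m "is"
    using integral_distr[OF assms(11) meas, of "is"] unif_sphere_tensor_moment[OF D that]
    by (simp add: assms(12))
  \<comment> \<open>Mass one is inherited from the law of \<open>X\<close>; it is the input from
    which nonnegativity of the density is derived.\<close>
  have "prob_space (Cdist k \<mu> \<rho>)"
    using prob_space.prob_space_distr[OF assms(1,9)] by (simp add: assms(10))
  note C = integral_Cdist[OF D d k \<mu> this continuous_on_tpow]
  \<comment> \<open>The degree is quantified afresh because the formula is applied both with m and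
    with k.\<close>
  have X: "(\<integral>\<omega>. tpow (X \<omega>) is \<partial>M) = mu_unif d m is + \<rho> / gegen d k 1 * (\<integral>x. tpow x is * gegen_poly d k (\<mu> \<bullet> x) \<partial>unif_sphere)"
    if "length is = m" for m "is"
    using integral_distr[OF assms(9) meas, of "is"] C[of "is"] unif_sphere_tensor_moment[OF D that]
    by (simp add: assms(10))
  have coef: "\<rho> / gegen d k 1 * (g_kd k d * Gamma ((real d + 1) / 2) / ((real d - 1) / 2 + real k) * t) = \<rho> / dkd k d * t" for t
  proof -
    have "\<rho> / gegen d k 1 * (g_kd k d * Gamma ((real d + 1) / 2) / ((real d - 1) / 2 + real k) * t) =
       \<rho> * (g_kd k d * Gamma ((real d + 1) / 2) / ((real d - 1) / 2 + real k) / gegen d k 1) * t"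
      by (simp only: divide_inverse mult_ac)
    thus ?thesis unfolding gegen_at_1_dkd[OF d k] by simp
  qed
  show ?thesis
  proof (intro conjI allI impI)
    fix "is" :: "'n list" assume "length is = m"
    thus "(\<integral>\<omega>. tpow (U \<omega>) is \<partial>M) = mu_unif d m is" by (rule U)
  next
    fix "is" :: "'n list" assume "m < k" "length is = m"
    thus "(\<integral>\<omega>. tpow (X \<omega>) is \<partial>M) = mu_unif d m is"
      using X[of "is" m] gegen_tensor_moment_zero[OF D d \<mu>, of m k "is"] by simp
  next
    fix "is" :: "'n list" assume l: "length is = k"
    show "(\<integral>\<omega>. tpow (X \<omega>) is \<partial>M) = mu_unif d k is + \<rho> / dkd k d *
            tsym k (\<lambda>js. \<Sum>j\<le>k div 2. a_coef d k j * tkron (2 * j) (tpowT 2 vecI j) (tpow \<mu>) js) is"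
      unfolding X[OF l] gegen_tensor_moment_eq[OF D d k \<mu> l] coef ..
  next
    fix "is" :: "'n list" assume "m > k \<and> odd (m - k)" "length is = m"
    thus "(\<integral>\<omega>. tpow (X \<omega>) is \<partial>M) = mu_unif d m is"
      using X[of "is" m] gegen_tensor_moment_zero[OF D d \<mu>, of m k "is"] by simp
  next
    fix j assume "even (m + k)" "j \<le> m div 2"
    thus "f_int d k m j = f_closed d k m j" by (rule f_int_eq_f_closed[OF d k])
  next
    fix "is" :: "'n list" assume l: "length is = m"
    show "(\<integral>\<omega>. tpow (X \<omega>) is \<partial>M) =
          mu_unif d m is + \<rho> / gegen d k 1 * (omega (d - 1) / omega d) *
            tsym m (\<lambda>js. \<Sum>j\<le>m div 2. e_coef d k m j *
               tkron (m - 2 * j) (tpow \<mu>) (tpowT 2 (\<lambda>ls. vecI ls - tpow \<mu> ls) j) js) is"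
      unfolding X[OF l] gegen_tensor_moment_general[OF D d k \<mu> l] by (simp only: mult.assoc)
  qed
qed

end
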